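(* Let $\alpha>0$, $p\ge2$, $t>0$, $\nu>0$ be fixed. For odd $N=2K+1$, $K\ge1$, let $\mathbb{H}_N$ be the space of real periodic grid functions, let $f_N\in\mathbb{H}_N$, let $\mathcal{L}_N=(-\Delta_N)^\alpha+\nu_N\,\mathrm{id}$ with $\nu_N=\nu$, and let $$G_N(v_N)=\tfrac12\|(-\Delta_N)^{\alpha/2}v_N\|_{N,2}^2+\tfrac1p\|v_N\|_{N,p}^p+\tfrac t2\|v_N\|_{N,2}^2-(f_N,v_N)_N,\qquad v_N\in\mathbb{H}_N.$$ Then: (i) For every $N$, $G_N$ is strongly convex and locally Lipschitz smooth with respect to the $\mathcal{L}_N$-norm, and the strong convexity constant $\hat\mu_N$ can be taken independent of $N$. (ii) Suppose in addition that $\alpha\in(0,1]$, and that $p\in[2,\frac{2}{1-\alpha}]$ if $\alpha<1$, or $p\in[2,\infty)$ if $\alpha=1$; and that there are $f\in L^2(\Omega)$ and a constant $C>0$ independent of $N$ such that $\|f_N\|_{N,2}\le C\|f\|_{L^2(\Omega)}$ for all $N$. Then the local Lipschitz smoothness constant is also independent of $N$ in the following sense: for each $M\in\mathbb{R}$ there is a constant $\hat L_N>0$ independent of $N$ such that, for every $N$, $G_N$ is $\hat L_N$-Lipschitz smooth with respect to the $\mathcal{L}_N$-norm on the sublevel set $\{v_N\in\mathbb{H}_N: G_N(v_N)\le M\}$. Consequently, the inverse condition number $\hat\mu_N/\hat L_N$ with respect to the $\mathcal{L}_N$-norm stays bounded away from $0$ as $N\to\infty$.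
   Context: $\Omega=(0,1)^2$. For $N=2K+1$ with an integer $K\ge1$ put $h=1/N$, grid $\Omega_N=\{(\ell h,mh):0\le\ell,m\le N\}$, $\mathbb{N}_N^2=\{\mathbf m\in\mathbb{Z}^2:1\le m_1,m_2\le N\}$, $\mathbb{Z}_K^2=\{\mathbf r\in\mathbb{Z}^2:-K\le r_1,r_2\le K\}$, and $\mathbf x_{\mathbf m}=(m_1h,m_2h)$. $\mathbb{H}_N$ is the space of functions $v_N:\Omega_N\to\mathbb{R}$ with $v_N(0,hm)=v_N(hN,hm)$ and $v_N(h\ell,0)=v_N(h\ell,hN)$ for $0\le\ell,m\le N$. Inner product: $(v_N,w_N)_N=h^2\sum_{\mathbf m\in\mathbb{N}_N^2}v_N(\mathbf x_{\mathbf m})w_N(\mathbf x_{\mathbf m})$; norms: $\|w_N\|_{N,p}=\big(h^2\sum_{\mathbf m\in\mathbb{N}_N^2}|w_N(\mathbf x_{\mathbf m})|^p\big)^{1/p}$. Discrete Fourier transform: $\hat w_K(\mathbf r)=h^2\sum_{\mathbf s\in\mathbb{N}_N^2}w_N(\mathbf x_{\mathbf s})e^{-2\pi i\,\mathbf r\cdot\mathbf x_{\mathbf s}}$, $\mathbf r\in\mathbb{Z}_K^2$. Discrete fractional Laplacian, for any exponent $\beta>0$: $[(-\Delta_N)^\beta w_N](\mathbf x_{\mathbf m})=\sum_{\mathbf r\in\mathbb{Z}_K^2}(4\pi^2|\mathbf r|^2)^\beta\hat w_K(\mathbf r)e^{2\pi i\,\mathbf r\cdot\mathbf x_{\mathbf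 m}}$. The $\mathcal{L}_N$-inner product is $(v_N,w_N)_{\mathcal{L}_N}=\nu_N(v_N,w_N)_N+((-\Delta_N)^{\alpha/2}v_N,(-\Delta_N)^{\alpha/2}w_N)_N$, with norm $\|v_N\|_{\mathcal{L}_N}=\sqrt{(v_N,v_N)_{\mathcal{L}_N}}$. With $\langle G_N'(v),w\rangle$ denoting the derivative of $G_N$ at $v$ in direction $w$: $G_N$ is $\mu$-strongly convex with respect to the $\mathcal{L}_N$-norm (with strong convexity constant $\mu>0$) if $\langle G_N'(v)-G_N'(w),v-w\rangle\ge\mu\|v-w\|_{\mathcal{L}_N}^2$ for all $v,w\in\mathbb{H}_N$; it is $L$-Lipschitz smooth on a set $B$ if $\langle G_N'(v)-G_N'(w),v-w\rangle\le L\|v-w\|_{\mathcal{L}_N}^2$ for all $v,w\in B$; it is locally Lipschitz smooth if for every bounded convex $B\subset\mathbb{H}_N$ it is $L_B$-Lipschitz smooth on $B$ for some $L_B>0$. *)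

theory Defs
  imports "HOL-Analysis.Analysis"
begin

section \<open>Periodic grid functions on the unit square\<close>

definition grid_sizes :: "nat set" where
  "grid_sizes = {N. \<exists>K\<ge>1. N = 2 * K + 1}"

definition mesh :: "nat \<Rightarrow> real" where
  "mesh N = 1 / real N"

definition grid_point :: "nat \<Rightarrow> nat \<times> nat \<Rightarrow> real \<times> real" where
  "grid_point N m = (real (fst m) * mesh N, real (snd m) * mesh N)"

definition grid :: "nat \<Rightarrow> (real \<times> real) set" where
  "grid N = grid_point N ` ({0..N} \<times> {0..N})"

definition grid_indices :: "nat \<Rightarrow> (nat \<times> nat) set" where
  "grid_indices N = {1..N} \<times> {1..N}"

text \<open>The frequencies range over \<open>{-K..K}\<^sup>2\<close> with \<open>N = 2K + 1\<close>.\<close>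
definition frequencies :: "nat \<Rightarrow> (int \<times> int) set" where
  "frequencies N = (let K = int ((N - 1) div 2) in {- K..K} \<times> {- K..K})"

text \<open>A real function on the grid is encoded as a function on the plane that vanishes off the
  grid; with this normalisation the encoding is unique and compatible with pointwise linear
  combinations.\<close>
definition grid_space :: "nat \<Rightarrow> (real \<times> real \<Rightarrow> real) set" where
  "grid_space N = {v.
     (\<forall>x. x \<notin> grid N \<longrightarrow> v x = 0) \<and>
     (\<forall>m\<le>N. v (grid_point N (0, m)) = v (grid_point N (N, m))) \<and>
     (\<forall>l\<le>N. v (grid_point N (l, 0)) = v (grid_point N (l, N)))}"

definition inner_N :: "nat \<Rightarrow> (real \<times> real \<Rightarrow> real) \<Rightarrow> (real \<times> real \<Rightarrow> real) \<Rightarrow> real" where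
  "inner_N N v w = (mesh N)\<^sup>2 * (\<Sum>m\<in>grid_indices N. v (grid_point N m) * w (grid_point N m))"

definition norm_N :: "nat \<Rightarrow> real \<Rightarrow> (real \<times> real \<Rightarrow> real) \<Rightarrow> real" where
  "norm_N N p w = ((mesh N)\<^sup>2 * (\<Sum>m\<in>grid_indices N. \<bar>w (grid_point N m)\<bar> powr p)) powr (1 / p)"

section \<open>Discrete Fourier transform and discrete fractional Laplacian\<close>

definition freq_dot :: "int \<times> int \<Rightarrow> real \<times> real \<Rightarrow> real" where
  "freq_dot r x = of_int (fst r) * fst x + of_int (snd r) * snd x"

definition dft :: "nat \<Rightarrow> (real \<times> real \<Rightarrow> real) \<Rightarrow> int \<times> int \<Rightarrow> complex" where
  "dft N w r = of_real ((mesh N)\<^sup>2) *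
     (\<Sum>s\<in>grid_indices N. of_real (w (grid_point N s)) * cis (- 2 * pi * freq_dot r (grid_point N s)))"

definition frac_laplacian_sum :: "nat \<Rightarrow> real \<Rightarrow> (real \<times> real \<Rightarrow> real) \<Rightarrow> real \<times> real \<Rightarrow> complex" where
  "frac_laplacian_sum N \<beta> w x =
     (\<Sum>r\<in>frequencies N.
        of_real ((4 * pi\<^sup>2 * (of_int (fst r) ^ 2 + of_int (snd r) ^ 2)) powr \<beta>)
          * dft N w r * cis (2 * pi * freq_dot r x))"

text \<open>The Fourier sum is real by the symmetry of the frequency set, so taking the real part only
  changes the type (\<open>frac_laplacian_sum_real\<close> below).\<close>
definition frac_laplacian :: "nat \<Rightarrow> real \<Rightarrow> (real \<times> real \<Rightarrow> real) \<Rightarrow> real \<times> real \<Rightarrow> real" where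
  "frac_laplacian N \<beta> w x = (if x \<in> grid N then Re (frac_laplacian_sum N \<beta> w x) else 0)"

lemma frac_laplacian_sum_real:
  "frac_laplacian_sum N \<beta> w x = of_real (Re (frac_laplacian_sum N \<beta> w x))"
proof -
  let ?n = "\<lambda>r::int \<times> int. (- fst r, - snd r)"
  have bij: "bij_betw ?n (frequencies N) (frequencies N)"
    by (rule bij_betw_byWitness[where f' = ?n]) (auto simp: frequencies_def Let_def)
  have dft_neg: "dft N w (?n r) = cnj (dft N w r)" for r
    by (simp add: dft_def freq_dot_def cis_cnj algebra_simps)
  have "cnj (frac_laplacian_sum N \<beta> w x) =
     (\<Sum>r\<in>frequencies N.
        of_real ((4 * pi\<^sup>2 * (of_int (fst (?n r)) ^ 2 + of_int (snd (?n r)) ^ 2)) powr \<beta>)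
          * dft N w (?n r) * cis (2 * pi * freq_dot (?n r) x))"
    unfolding frac_laplacian_sum_def dft_neg
    by (simp add: freq_dot_def cis_cnj algebra_simps)
  also have "\<dots> = frac_laplacian_sum N \<beta> w x"
    unfolding frac_laplacian_sum_def by (rule sum.reindex_bij_betw[OF bij])
  finally have "frac_laplacian_sum N \<beta> w x \<in> \<real>"
    by (simp add: Reals_cnj_iff)
  then show ?thesis
    by simp
qed

lemma frac_laplacian_in_grid_space:
  assumes "N > 0"
  shows "frac_laplacian N \<beta> w \<in> grid_space N"
proof -
  have per: "cis (2 * pi * (of_int k + y)) = cis (2 * pi * y)" for k y
    by (simp add: distrib_left flip: cis_mult)
  have h: "real N * mesh N = 1"
    using assms by (simp add: mesh_def)
  have 1: "cis (2 * pi * freq_dot r (grid_point N (N, m))) = cis (2 * pi * freq_dot r (grid_point N (0, m)))"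
    for r m
    using per[of "fst r"] by (simp add: freq_dot_def grid_point_def h)
  have 2: "cis (2 * pi * freq_dot r (grid_point N (l, N))) = cis (2 * pi * freq_dot r (grid_point N (l, 0)))"
    for r l
    using per[of "snd r" "of_int (fst r) * (real l * mesh N)"]
    by (simp add: freq_dot_def grid_point_def h add.commute)
  have g: "grid_point N (l, m) \<in> grid N" if "l \<le> N" "m \<le> N" for l m
    using that by (auto simp: grid_def)
  show ?thesis
    by (simp add: grid_space_def frac_laplacian_def frac_laplacian_sum_def 1 2 g)
qed

section \<open>The inner product induced by the shifted fractional Laplacian\<close>

text \<open>The form of the operator \<open>(-\<Delta>\<^sub>N)\<^sup>\<alpha> + \<nu> id\<close>.\<close>
definition inner_L ::
  "nat \<Rightarrow> real \<Rightarrow> real \<Rightarrow> (real \<times> real \<Rightarrow> real) \<Rightarrow> (real \<times> real \<Rightarrow> real) \<Rightarrow> real" where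
  "inner_L N \<alpha> \<nu> v w =
     \<nu> * inner_N N v w + inner_N N (frac_laplacian N (\<alpha> / 2) v) (frac_laplacian N (\<alpha> / 2) w)"

definition norm_L :: "nat \<Rightarrow> real \<Rightarrow> real \<Rightarrow> (real \<times> real \<Rightarrow> real) \<Rightarrow> real" where
  "norm_L N \<alpha> \<nu> v = sqrt (inner_L N \<alpha> \<nu> v v)"

section \<open>Strong convexity and Lipschitz smoothness\<close>

definition dir_deriv ::
  "((real \<times> real \<Rightarrow> real) \<Rightarrow> real) \<Rightarrow> (real \<times> real \<Rightarrow> real) \<Rightarrow> (real \<times> real \<Rightarrow> real) \<Rightarrow> real" where
  "dir_deriv G v w = deriv (\<lambda>s. G (\<lambda>x. v x + s * w x)) 0"

text \<open>\<open>deriv\<close> is total; the two notions below therefore require explicitly that the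
  derivatives they mention exist.\<close>
definition dir_differentiable :: "nat \<Rightarrow> ((real \<times> real \<Rightarrow> real) \<Rightarrow> real) \<Rightarrow> bool" where
  "dir_differentiable N G \<longleftrightarrow>
     (\<forall>v\<in>grid_space N. \<forall>w\<in>grid_space N.
        (\<lambda>s::real. G (\<lambda>x. v x + s * w x)) field_differentiable (at 0))"

definition strongly_convex ::
  "nat \<Rightarrow> real \<Rightarrow> real \<Rightarrow> ((real \<times> real \<Rightarrow> real) \<Rightarrow> real) \<Rightarrow> real \<Rightarrow> bool" where
  "strongly_convex N \<alpha> \<nu> G \<mu> \<longleftrightarrow>
     dir_differentiable N G \<and>
     (\<forall>v\<in>grid_space N. \<forall>w\<in>grid_space N.
        dir_deriv G v (\<lambda>x. v x - w x) - dir_deriv G w (\<lambda>x. v x - w x)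
          \<ge> \<mu> * (norm_L N \<alpha> \<nu> (\<lambda>x. v x - w x))\<^sup>2)"

definition lipschitz_smooth_on ::
  "nat \<Rightarrow> real \<Rightarrow> real \<Rightarrow> (real \<times> real \<Rightarrow> real) set \<Rightarrow> ((real \<times> real \<Rightarrow> real) \<Rightarrow> real) \<Rightarrow> real \<Rightarrow> bool" where
  "lipschitz_smooth_on N \<alpha> \<nu> B G L \<longleftrightarrow>
     dir_differentiable N G \<and>
     (\<forall>v\<in>B. \<forall>w\<in>B.
        dir_deriv G v (\<lambda>x. v x - w x) - dir_deriv G w (\<lambda>x. v x - w x)
          \<le> L * (norm_L N \<alpha> \<nu> (\<lambda>x. v x - w x))\<^sup>2)"

text \<open>Function types carry no vector space structure here, so convexity and
  boundedness are spelled out.\<close>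
definition grid_convex :: "(real \<times> real \<Rightarrow> real) set \<Rightarrow> bool" where
  "grid_convex B \<longleftrightarrow>
     (\<forall>v\<in>B. \<forall>w\<in>B. \<forall>s\<in>{0..1::real}. (\<lambda>x. (1 - s) * v x + s * w x) \<in> B)"

definition grid_bounded :: "nat \<Rightarrow> real \<Rightarrow> real \<Rightarrow> (real \<times> real \<Rightarrow> real) set \<Rightarrow> bool" where
  "grid_bounded N \<alpha> \<nu> B \<longleftrightarrow> (\<exists>R. \<forall>v\<in>B. norm_L N \<alpha> \<nu> v \<le> R)"

definition locally_lipschitz_smooth ::
  "nat \<Rightarrow> real \<Rightarrow> real \<Rightarrow> ((real \<times> real \<Rightarrow> real) \<Rightarrow> real) \<Rightarrow> bool" where
  "locally_lipschitz_smooth N \<alpha> \<nu> G \<longleftrightarrow>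
     (\<forall>B. B \<subseteq> grid_space N \<and> grid_bounded N \<alpha> \<nu> B \<and> grid_convex B \<longrightarrow>
        (\<exists>L>0. lipschitz_smooth_on N \<alpha> \<nu> B G L))"

section \<open>The energy\<close>

definition energy ::
  "nat \<Rightarrow> real \<Rightarrow> real \<Rightarrow> real \<Rightarrow> (real \<times> real \<Rightarrow> real) \<Rightarrow> (real \<times> real \<Rightarrow> real) \<Rightarrow> real" where
  "energy N \<alpha> p t f v =
     1 / 2 * (norm_N N 2 (frac_laplacian N (\<alpha> / 2) v))\<^sup>2
     + 1 / p * norm_N N p v powr p
     + t / 2 * (norm_N N 2 v)\<^sup>2
     - inner_N N f v"

definition sublevel :: "nat \<Rightarrow> ((real \<times> real \<Rightarrow> real) \<Rightarrow> real) \<Rightarrow> real \<Rightarrow> (real \<times> real \<Rightarrow> real) set" where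
  "sublevel N G M = {v \<in> grid_space N. G v \<le> M}"

section \<open>Square integrable functions on the open unit square\<close>

definition unit_square :: "(real \<times> real) set" where
  "unit_square = {0<..<1} \<times> {0<..<1}"

definition square_integrable :: "(real \<times> real \<Rightarrow> real) \<Rightarrow> bool" where
  "square_integrable f \<longleftrightarrow>
     f \<in> borel_measurable (lebesgue_on unit_square) \<and>
     integrable (lebesgue_on unit_square) (\<lambda>x. (f x)\<^sup>2)"

definition L2_norm :: "(real \<times> real \<Rightarrow> real) \<Rightarrow> real" where
  "L2_norm f = sqrt (integral\<^sup>L (lebesgue_on unit_square) (\<lambda>x. (f x)\<^sup>2))"

end

theory Submission
  imports Defs
begin

text \<open>Write \<open>u = v - w\<close>. Since the derivative of \<open>|a|\<^sup>p / p\<close> is \<open>|a|\<^sup>p\<^sup>-\<^sup>2 a\<close>, the difference of the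
  derivatives of the energy at \<open>v\<close> and \<open>w\<close> in direction \<open>u\<close> is the sum of
  \<open>\<parallel>(-\<Delta>\<^sub>N)\<^sup>\<alpha>\<^sup>/\<^sup>2 u\<parallel>\<^sup>2\<close>, of \<open>t \<parallel>u\<parallel>\<^sup>2\<close> and of the grid average of
  \<open>(|v|\<^sup>p\<^sup>-\<^sup>2 v - |w|\<^sup>p\<^sup>-\<^sup>2 w) (v - w)\<close> (\<open>energy_gradient_diff\<close>). The last term is nonnegative and at
  most \<open>(p - 1) max(|v|,|w|)\<^sup>p\<^sup>-\<^sup>2 u\<^sup>2\<close> (\<open>power_map_monotone\<close>). Nonnegativity gives strong
  convexity with constant \<open>min 1 (t / \<nu>)\<close>. The upper bound gives local Lipschitz smoothness,
  because on a single grid the \<open>\<L>\<^sub>N\<close>-norm controls every point value.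

  For a Lipschitz constant that is uniform in \<open>N\<close>, a bound \<open>M\<close> on the energy first
  bounds the \<open>L\<^sup>p\<close> norms of \<open>v\<close> and \<open>w\<close> (\<open>powr_sum_le_of_energy_le\<close>). It remains to
  estimate the grid average of \<open>max(|v|,|w|)\<^sup>p\<^sup>-\<^sup>2 u\<^sup>2\<close> by the squared \<open>\<L>\<^sub>N\<close>-norm of \<open>u\<close>. This
  follows from the pointwise inequality \<open>x\<^sup>p\<^sup>-\<^sup>2 y\<^sup>2 \<le> x\<^sup>p + y\<^sup>p\<close>, applied with \<open>y\<close> the normalised
  \<open>u\<close>, and from the Sobolev embedding of the \<open>\<L>\<^sub>N\<close>-norm into \<open>L\<^sup>p\<close> with a constant that does
  not depend on \<open>N\<close> (\<open>discrete_sobolev\<close>).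

  The embedding, which includes the critical exponent \<open>p = 2 / (1 - \<alpha>)\<close>, is proved directly
  on the grid by the dyadic argument of Chemin and Xu, with \<open>s = 1 - 2 / p\<close>. The part of a
  function with frequencies below \<open>2\<^sup>k\<close> is bounded pointwise by a multiple of \<open>2\<^sup>k\<^sup>(\<^sup>1\<^sup>-\<^sup>s\<^sup>)\<close>, by
  the Cauchy--Schwarz inequality (\<open>norm_trig_sum_low_le\<close>). At each grid point the level \<open>k\<close> is
  chosen so that this bound is at most half of the value there; then the part above \<open>2\<^sup>k\<close>
  accounts for at least the other half, and its square can be summed over the grid by the
  Parseval identity (\<open>parseval\<close>). The resulting geometric sums over \<open>k\<close> add up to the
  Sobolev weight (\<open>critical_sobolev_trig_sum\<close>). Only the characters of the grid and their
  orthogonality are used, and no interpolation between the grid and the continuum.\<close>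

section \<open>Orthogonality of the discrete characters\<close>

lemma sum_cis_period:
  fixes a j :: int
  assumes "N > 0"
  shows "(\<Sum>k\<in>{a..<a + int N}. cis (2 * pi * (real_of_int j * real_of_int k / real N)))
    = (if int N dvd j then of_nat N else 0)"
proof -
  define z where "z = cis (2 * pi * (real_of_int j / real N))"
  have "bij_betw (\<lambda>i. a + int i) {..<N} {a..<a + int N}"
    by (rule bij_betw_byWitness[where f' = "\<lambda>k. nat (k - a)"]) auto
  then have "(\<Sum>k\<in>{a..<a + int N}. cis (2 * pi * (real_of_int j * real_of_int k / real N)))
      = (\<Sum>i<N. cis (2 * pi * (real_of_int j * real_of_int (a + int i) / real N)))"
    by (rule sum.reindex_bij_betw[symmetric])
  also have "\<dots> = (\<Sum>i<N. cis (2 * pi * (real_of_int j * real_of_int a / real N)) * z ^ i)"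
    using assms unfolding z_def Complex.DeMoivre cis_mult
    by (intro sum.cong refl arg_cong[where f = cis]) (simp add: field_simps)
  also have "\<dots> = cis (2 * pi * (real_of_int j * real_of_int a / real N)) * (\<Sum>i<N. z ^ i)"
    by (simp add: sum_distrib_left)
  also have "\<dots> = (if int N dvd j then of_nat N else 0)"
  proof (cases "int N dvd j")
    case True
    then obtain b where b: "j = int N * b" by auto
    have per: "cis (2 * pi * real_of_int n) = 1" for n
      by simp
    have "z = 1"
      using per[of b] assms by (simp add: z_def b)
    moreover have "cis (2 * pi * (real_of_int j * real_of_int a / real N)) = 1"
      using per[of "b * a"] assms by (simp add: b)
    ultimately show ?thesis using True by simp
  next
    case False
    have "z \<noteq> 1"
    proof
      assume "z = 1"
      then have "cos (2 * pi * (real_of_int j / real N)) = 1"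
        by (simp add: z_def complex_eq_iff)
      then obtain n :: int where "2 * pi * (real_of_int j / real N) = real_of_int n * 2 * pi"
        by (auto simp: cos_one_2pi_int)
      then have "real_of_int j = real_of_int (n * int N)"
        using assms by (simp add: field_simps)
      then have "j = n * int N"
        by (simp only: of_int_eq_iff)
      then show False using False by simp
    qed
    moreover have "z ^ N = 1"
    proof -
      have "z ^ N = cis (2 * pi * real_of_int j)"
        using assms unfolding z_def Complex.DeMoivre by simp
      then show ?thesis by simp
    qed
    ultimately have "(\<Sum>i<N. z ^ i) = 0"
      by (simp add: sum_gp_strict)
    then show ?thesis using False by simp
  qed
  finally show ?thesis .
qed

lemma finite_frequencies [simp]: "finite (frequencies N)"
  by (simp add: frequencies_def Let_def)

lemma finite_grid_indices [simp]: "finite (grid_indices N)"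
  by (simp add: grid_indices_def)

lemma character_orthogonal:
  assumes N: "N \<in> grid_sizes" and r: "r \<in> frequencies N" and q: "q \<in> frequencies N"
  shows "of_real ((mesh N)\<^sup>2) * (\<Sum>m\<in>grid_indices N.
      cis (2 * pi * freq_dot r (grid_point N m)) * cis (- 2 * pi * freq_dot q (grid_point N m)))
    = (if r = q then 1 else (0::complex))"
proof -
  obtain K where K: "K \<ge> 1" "N = 2 * K + 1"
    using N by (auto simp: grid_sizes_def)
  have N0: "N > 0" using K by simp
  obtain r1 r2 q1 q2 where rq: "r = (r1, r2)" "q = (q1, q2)"
    by (metis surj_pair)
  have line: "(\<Sum>i\<in>{1..N}. cis (2 * pi * (real_of_int j * real i / real N)))
      = (if int N dvd j then of_nat N else 0)" for j
  proof -
    have "bij_betw int {1..N} {1..<1 + int N}"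
      by (rule bij_betw_byWitness[where f' = nat]) auto
    from sum.reindex_bij_betw[OF this, of "\<lambda>k. cis (2 * pi * (real_of_int j * real_of_int k / real N))"]
    show ?thesis using sum_cis_period[OF N0, where a = 1 and j = j] by simp
  qed
  have dv: "int N dvd b - c \<longleftrightarrow> b = c"
    if "\<bar>b\<bar> \<le> int K" "\<bar>c\<bar> \<le> int K" for b c
  proof
    assume d: "int N dvd b - c"
    show "b = c"
    proof (rule ccontr)
      assume "b \<noteq> c"
      then have "int N \<le> \<bar>b - c\<bar>"
        using zdvd_imp_le[of "int N" "\<bar>b - c\<bar>"] d by simp
      then show False using that K by auto
    qed
  qed simp
  have "(\<Sum>m\<in>grid_indices N.
      cis (2 * pi * freq_dot r (grid_point N m)) * cis (- 2 * pi * freq_dot q (grid_point N m)))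
    = (\<Sum>(i, l)\<in>{1..N} \<times> {1..N}. cis (2 * pi * (real_of_int (r1 - q1) * real i / real N))
         * cis (2 * pi * (real_of_int (r2 - q2) * real l / real N)))"
    unfolding grid_indices_def cis_mult
    by (intro sum.cong refl)
      (auto simp: freq_dot_def grid_point_def mesh_def rq algebra_simps
        add_divide_distrib diff_divide_distrib intro!: arg_cong[where f = cis])
  also have "\<dots> = (if int N dvd r1 - q1 then of_nat N else 0) * (if int N dvd r2 - q2 then of_nat N else 0)"
    by (simp add: sum_product sum.cartesian_product flip: line)
  also have "\<dots> = (if r = q then of_nat N * of_nat N else 0)"
  proof -
    have "r1 \<in> {- int K..int K}" "q1 \<in> {- int K..int K}" "r2 \<in> {- int K..int K}" "q2 \<in> {- int K..int K}"
      using r q K by (auto simp: rq frequencies_def Let_def)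
    then have "int N dvd r1 - q1 \<longleftrightarrow> r1 = q1" "int N dvd r2 - q2 \<longleftrightarrow> r2 = q2"
      by (auto intro!: dv)
    then show ?thesis by (simp add: rq)
  qed
  finally show ?thesis
    using N0 by (auto simp: mesh_def power2_eq_square)
qed

lemma character_complete:
  assumes N: "N \<in> grid_sizes" and m: "m \<in> grid_indices N" and s: "s \<in> grid_indices N"
  shows "of_real ((mesh N)\<^sup>2) * (\<Sum>r\<in>frequencies N.
      cis (2 * pi * freq_dot r (grid_point N m)) * cis (- 2 * pi * freq_dot r (grid_point N s)))
    = (if m = s then 1 else (0::complex))"
proof -
  obtain K where K: "K \<ge> 1" "N = 2 * K + 1"
    using N by (auto simp: grid_sizes_def)
  have N0: "N > 0" using K by simp
  obtain m1 m2 s1 s2 where ms: "m = (m1, m2)" "s = (s1, s2)"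
    by (metis surj_pair)
  have line: "(\<Sum>i\<in>{- int K..int K}. cis (2 * pi * (real_of_int j * real_of_int i / real N)))
      = (if int N dvd j then of_nat N else 0)" for j
  proof -
    have "{- int K..int K} = {- int K..<- int K + int N}"
      using K by auto
    then show ?thesis using sum_cis_period[OF N0, where a = "- int K" and j = j] by simp
  qed
  have dv: "int N dvd int b - int c \<longleftrightarrow> b = c"
    if "b \<in> {1..N}" "c \<in> {1..N}" for b c
  proof
    assume d: "int N dvd int b - int c"
    show "b = c"
    proof (rule ccontr)
      assume "b \<noteq> c"
      then have "int N \<le> \<bar>int b - int c\<bar>"
        using zdvd_imp_le[of "int N" "\<bar>int b - int c\<bar>"] d by simp
      then show False using that K by auto
    qed
  qed simp
  have fr: "frequencies N = {- int K..int K} \<times> {- int K..int K}"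
    using K by (simp add: frequencies_def Let_def)
  have "(\<Sum>r\<in>frequencies N.
      cis (2 * pi * freq_dot r (grid_point N m)) * cis (- 2 * pi * freq_dot r (grid_point N s)))
    = (\<Sum>(i, l)\<in>{- int K..int K} \<times> {- int K..int K}. 
         cis (2 * pi * (real_of_int (int m1 - int s1) * real_of_int i / real N))
         * cis (2 * pi * (real_of_int (int m2 - int s2) * real_of_int l / real N)))"
    unfolding fr cis_mult
    by (intro sum.cong refl)
      (auto simp: freq_dot_def grid_point_def mesh_def ms algebra_simps
        add_divide_distrib diff_divide_distrib intro!: arg_cong[where f = cis])
  also have "\<dots> = (if int N dvd int m1 - int s1 then of_nat N else 0)
      * (if int N dvd int m2 - int s2 then of_nat N else 0)"
    by (simp only: sum_product sum.cartesian_product flip: line)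
  also have "\<dots> = (if m = s then of_nat N * of_nat N else 0)"
    using m s dv[of m1 s1] dv[of m2 s2]
    by (auto simp: ms grid_indices_def)
  finally show ?thesis
    using N0 by (auto simp: mesh_def power2_eq_square)
qed

section \<open>Parseval identity and Fourier inversion\<close>

text \<open>Evaluation at \<open>x\<close> of the trigonometric polynomial with coefficients \<open>c\<close> and
  frequency set \<open>R\<close>. The set \<open>R\<close> is a parameter so that a grid function can be cut
  into low and high frequencies.\<close>
definition trig_sum ::
  "(int \<times> int) set \<Rightarrow> (int \<times> int \<Rightarrow> complex) \<Rightarrow> real \<times> real \<Rightarrow> complex" where
  "trig_sum R c x = (\<Sum>r\<in>R. c r * cis (2 * pi * freq_dot r x))"

text \<open>Any subset of the frequency square is allowed: the Sobolev inequality below needs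
  the identity for the high-frequency parts.\<close>
lemma parseval:
  assumes N: "N \<in> grid_sizes" and R: "R \<subseteq> frequencies N"
  shows "(mesh N)\<^sup>2 * (\<Sum>m\<in>grid_indices N. (cmod (trig_sum R c (grid_point N m)))\<^sup>2)
    = (\<Sum>r\<in>R. (cmod (c r))\<^sup>2)"
proof -
  let ?e = "\<lambda>r m. cis (2 * pi * freq_dot r (grid_point N m))"
  let ?g = "\<lambda>r m. cis (- 2 * pi * freq_dot r (grid_point N m))"
  have finR: "finite R" using R by (rule finite_subset) simp
  have "complex_of_real ((mesh N)\<^sup>2 * (\<Sum>m\<in>grid_indices N. (cmod (trig_sum R c (grid_point N m)))\<^sup>2))
    = of_real ((mesh N)\<^sup>2) * (\<Sum>m\<in>grid_indices N. \<Sum>r\<in>R. \<Sum>q\<in>R. (c r * cnj (c q)) * (?e r m * ?g q m))"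
  proof -
    have "complex_of_real ((cmod (trig_sum R c (grid_point N m)))\<^sup>2)
        = (\<Sum>r\<in>R. \<Sum>q\<in>R. (c r * cnj (c q)) * (?e r m * ?g q m))" for m
      unfolding complex_norm_square trig_sum_def cnj_sum sum_product
      by (intro sum.cong refl) (simp add: cis_cnj)
    then show ?thesis by (simp only: of_real_mult of_real_sum)
  qed
  also have "\<dots> = of_real ((mesh N)\<^sup>2) * (\<Sum>r\<in>R. \<Sum>q\<in>R. \<Sum>m\<in>grid_indices N. (c r * cnj (c q)) * (?e r m * ?g q m))"
  proof -
    have "(\<Sum>m\<in>grid_indices N. \<Sum>r\<in>R. \<Sum>q\<in>R. h r q m) = (\<Sum>r\<in>R. \<Sum>q\<in>R. \<Sum>m\<in>grid_indices N. h r q m)"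
      for h :: "_ \<Rightarrow> _ \<Rightarrow> _ \<Rightarrow> complex"
    proof -
      have "(\<Sum>m\<in>grid_indices N. \<Sum>r\<in>R. \<Sum>q\<in>R. h r q m)
          = (\<Sum>r\<in>R. \<Sum>m\<in>grid_indices N. \<Sum>q\<in>R. h r q m)"
        by (rule sum.swap)
      also have "\<dots> = (\<Sum>r\<in>R. \<Sum>q\<in>R. \<Sum>m\<in>grid_indices N. h r q m)"
        by (intro sum.cong refl sum.swap)
      finally show ?thesis .
    qed
    then show ?thesis by (rule arg_cong)
  qed
  also have "\<dots> = (\<Sum>r\<in>R. \<Sum>q\<in>R. (c r * cnj (c q)) *
      (of_real ((mesh N)\<^sup>2) * (\<Sum>m\<in>grid_indices N. ?e r m * ?g q m)))"
    by (simp only: sum_distrib_left mult.left_commute)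
  also have "\<dots> = (\<Sum>r\<in>R. \<Sum>q\<in>R. (c r * cnj (c q)) * (if r = q then 1 else 0))"
    using R by (intro sum.cong refl) (subst character_orthogonal[OF N], auto)
  also have "\<dots> = (\<Sum>r\<in>R. c r * cnj (c r))"
    using finR by (simp add: sum.delta if_distrib cong: if_cong)
  also have "\<dots> = complex_of_real (\<Sum>r\<in>R. (cmod (c r))\<^sup>2)"
    by (simp add: complex_norm_square del: of_real_power)
  finally show ?thesis by (simp only: of_real_eq_iff)
qed

lemma dft_inversion:
  assumes N: "N \<in> grid_sizes" and m: "m \<in> grid_indices N"
  shows "trig_sum (frequencies N) (dft N w) (grid_point N m) = of_real (w (grid_point N m))"
proof -
  let ?e = "\<lambda>r m. cis (2 * pi * freq_dot r (grid_point N m))"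
  let ?g = "\<lambda>r m. cis (- 2 * pi * freq_dot r (grid_point N m))"
  have "trig_sum (frequencies N) (dft N w) (grid_point N m)
     = (\<Sum>r\<in>frequencies N. \<Sum>s\<in>grid_indices N.
          of_real (w (grid_point N s)) * (of_real ((mesh N)\<^sup>2) * (?e r m * ?g r s)))"
    unfolding trig_sum_def dft_def sum_distrib_left sum_distrib_right
    by (intro sum.cong refl) (simp only: ac_simps)
  also have "\<dots> = (\<Sum>s\<in>grid_indices N. of_real (w (grid_point N s)) *
        (of_real ((mesh N)\<^sup>2) * (\<Sum>r\<in>frequencies N. ?e r m * ?g r s)))"
    by (subst sum.swap) (simp only: sum_distrib_left)
  also have "\<dots> = (\<Sum>s\<in>grid_indices N. of_real (w (grid_point N s)) * (if m = s then 1 else 0))"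
    using m by (intro sum.cong refl) (subst character_complete[OF N], auto)
  also have "\<dots> = of_real (w (grid_point N m))"
    using m by (simp add: sum.delta if_distrib cong: if_cong)
  finally show ?thesis .
qed

lemma inner_N_self:
  assumes N: "N \<in> grid_sizes"
  shows "inner_N N w w = (\<Sum>r\<in>frequencies N. (cmod (dft N w r))\<^sup>2)"
proof -
  have "inner_N N w w = (mesh N)\<^sup>2 * (\<Sum>m\<in>grid_indices N.
      (cmod (trig_sum (frequencies N) (dft N w) (grid_point N m)))\<^sup>2)"
    by (simp add: inner_N_def dft_inversion[OF N] power2_eq_square)
  also have "\<dots> = (\<Sum>r\<in>frequencies N. (cmod (dft N w r))\<^sup>2)"
    by (rule parseval[OF N]) simp
  finally show ?thesis .
qed

text \<open>The Fourier symbol of \<open>-\<Delta>\<^sub>N\<close>.\<close>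
definition symbol :: "int \<times> int \<Rightarrow> real" where
  "symbol r = 4 * pi\<^sup>2 * (of_int (fst r) ^ 2 + of_int (snd r) ^ 2)"

lemma inner_N_frac_laplacian:
  assumes N: "N \<in> grid_sizes"
  shows "inner_N N (frac_laplacian N \<beta> w) (frac_laplacian N \<beta> w)
    = (\<Sum>r\<in>frequencies N. symbol r powr (2 * \<beta>) * (cmod (dft N w r))\<^sup>2)"
proof -
  let ?c = "\<lambda>r. of_real (symbol r powr \<beta>) * dft N w r"
  have at_grid: "(frac_laplacian N \<beta> w (grid_point N m))\<^sup>2
      = (cmod (trig_sum (frequencies N) ?c (grid_point N m)))\<^sup>2" if "m \<in> grid_indices N" for m
  proof -
    have "grid_point N m \<in> grid N"
      using that by (auto simp: grid_def grid_indices_def)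
    then have "cmod (frac_laplacian_sum N \<beta> w (grid_point N m)) = \<bar>frac_laplacian N \<beta> w (grid_point N m)\<bar>"
      by (subst frac_laplacian_sum_real) (simp add: frac_laplacian_def)
    moreover have "frac_laplacian_sum N \<beta> w x = trig_sum (frequencies N) ?c x" for x
      by (simp add: frac_laplacian_sum_def trig_sum_def symbol_def)
    ultimately show ?thesis by simp
  qed
  have "inner_N N (frac_laplacian N \<beta> w) (frac_laplacian N \<beta> w)
     = (mesh N)\<^sup>2 * (\<Sum>m\<in>grid_indices N. (cmod (trig_sum (frequencies N) ?c (grid_point N m)))\<^sup>2)"
    by (simp add: inner_N_def at_grid flip: power2_eq_square)
  also have "\<dots> = (\<Sum>r\<in>frequencies N. (cmod (?c r))\<^sup>2)"
    by (rule parseval[OF N]) simp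
  also have "\<dots> = (\<Sum>r\<in>frequencies N. symbol r powr (2 * \<beta>) * (cmod (dft N w r))\<^sup>2)"
  proof (intro sum.cong refl)
    fix r
    have "(symbol r powr \<beta>)\<^sup>2 = symbol r powr (2 * \<beta>)"
      by (simp only: power2_eq_square mult_2 powr_add)
    then show "(cmod (?c r))\<^sup>2 = symbol r powr (2 * \<beta>) * (cmod (dft N w r))\<^sup>2"
      by (simp add: norm_mult power_mult_distrib)
  qed
  finally show ?thesis .
qed

lemma inner_N_self_nonneg: "inner_N N w w \<ge> 0"
  by (simp add: inner_N_def sum_nonneg)

lemma norm_L_squared:
  assumes "\<nu> > 0"
  shows "(norm_L N \<alpha> \<nu> w)\<^sup>2 = \<nu> * inner_N N w w
    + inner_N N (frac_laplacian N (\<alpha> / 2) w) (frac_laplacian N (\<alpha> / 2) w)"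
  using assms by (simp add: norm_L_def inner_L_def inner_N_self_nonneg)

section \<open>The critical discrete Sobolev inequality\<close>

text \<open>The maximum norm of a frequency, raised to \<open>1\<close> at the zero frequency so that negative
  powers of it make sense as weights.\<close>
definition freq_size :: "int \<times> int \<Rightarrow> real" where
  "freq_size r = max 1 (of_int (max \<bar>fst r\<bar> \<bar>snd r\<bar>))"

lemma freq_size_ge_1: "freq_size r \<ge> 1"
  by (simp add: freq_size_def)

lemma low_frequencies:
  shows finite_low_frequencies: "finite {r. freq_size r < 2 ^ k}"
    and card_low_frequencies: "card {r. freq_size r < 2 ^ k} \<le> 4 ^ (k + 1)"
proof -
  let ?I = "{- (2 ^ k)..<2 ^ k} :: int set"
  have cI: "card ?I = 2 * 2 ^ k"
    by (simp add: nat_mult_distrib nat_power_eq flip: mult_2)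
  have sub: "{r. freq_size r < 2 ^ k} \<subseteq> ?I \<times> ?I"
  proof
    fix r assume "r \<in> {r. freq_size r < 2 ^ k}"
    then have "real_of_int (max \<bar>fst r\<bar> \<bar>snd r\<bar>) < real_of_int (2 ^ k)"
      by (simp add: freq_size_def)
    then have "max \<bar>fst r\<bar> \<bar>snd r\<bar> < 2 ^ k"
      by (simp only: of_int_less_iff)
    then show "r \<in> ?I \<times> ?I"
      by (cases r) auto
  qed
  show "finite {r. freq_size r < 2 ^ k}"
    by (rule finite_subset[OF sub]) simp
  have "card {r. freq_size r < 2 ^ k} \<le> card (?I \<times> ?I)"
    by (rule card_mono[OF _ sub]) simp
  also have "\<dots> = 4 ^ (k + 1)"
    by (simp only: card_cartesian_product cI) (simp flip: power_mult_distrib)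
  finally show "card {r. freq_size r < 2 ^ k} \<le> 4 ^ (k + 1)" .
qed

lemma two_power_powr: "(2 ^ k) powr (2 * s) = (4 powr s) ^ k" for s :: real
proof -
  have "(2 ^ k) powr (2 * s) = (2 powr real k) powr (2 * s)"
    by (simp add: powr_realpow)
  also have "\<dots> = ((2 powr 2) powr s) powr real k"
    by (simp only: powr_powr mult_ac)
  also have "\<dots> = (4 powr s) ^ k"
    by (simp add: powr_realpow)
  finally show ?thesis .
qed

text \<open>In dimension two there are \<open>O(4\<^sup>k)\<close> frequencies of size about \<open>2\<^sup>k\<close>, each of weight
  \<open>4\<^sup>-\<^sup>s\<^sup>k\<close>. Because \<open>s < 1\<close>, the shell sums grow geometrically with ratio \<open>q\<close>, so the
  last shell dominates; the constant \<open>16 / (q - 1)\<close> is the one for which the induction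
  on \<open>k\<close> closes.\<close>
lemma sum_low_frequencies_le:
  fixes s :: real
  assumes "0 \<le> s" "s < 1"
  defines "q \<equiv> 4 powr (1 - s)"
  shows "(\<Sum>r | freq_size r < 2 ^ k. freq_size r powr (- 2 * s)) \<le> 16 / (q - 1) * q ^ k"
proof (induction k)
  case 0
  have q1: "q > 1" unfolding q_def using assms by simp
  have "{r. freq_size r < 2 ^ 0} = {}"
    using freq_size_ge_1 by (auto simp: not_less)
  then have "(\<Sum>r | freq_size r < 2 ^ 0. freq_size r powr (- 2 * s)) = 0"
    by (simp only: sum.empty)
  then show ?case using q1 by simp
next
  case (Suc k)
  have q1: "q > 1" unfolding q_def using assms by simp
  let ?shell = "{r. 2 ^ k \<le> freq_size r \<and> freq_size r < 2 ^ Suc k}"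
  have fin: "finite ?shell"
    by (rule finite_subset[OF _ finite_low_frequencies[of "Suc k"]]) auto
  have "real (card ?shell) \<le> real (card {r. freq_size r < 2 ^ Suc k})"
    by (intro of_nat_mono card_mono finite_low_frequencies) auto
  also have "\<dots> \<le> real (4 ^ (Suc k + 1))"
    by (intro of_nat_mono card_low_frequencies)
  finally have card: "real (card ?shell) \<le> 16 * 4 ^ k" by simp
  have split: "{r. freq_size r < 2 ^ Suc k} = {r. freq_size r < 2 ^ k} \<union> ?shell"
  proof -
    have "freq_size r < 2 ^ Suc k" if "freq_size r < 2 ^ k" for r
    proof -
      have "(2::real) ^ k \<le> 2 ^ Suc k" by simp
      then show ?thesis using that by linarith
    qed
    then show ?thesis by auto
  qed
  have "(\<Sum>r\<in>?shell. freq_size r powr (- 2 * s)) \<le> (\<Sum>r\<in>?shell. (2 ^ k) powr (- 2 * s))"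
    using assms by (intro sum_mono powr_mono2') auto
  also have "\<dots> \<le> (16 * 4 ^ k) * (2 ^ k) powr (- 2 * s)"
    using card by (simp add: mult_right_mono)
  also have "(2 ^ k) powr (- 2 * s) = (4 powr (- s)) ^ k"
    using two_power_powr[of k "- s"] by simp
  also have "(16 * 4 ^ k) * (4 powr (- s)) ^ k = 16 * q ^ k"
    by (simp add: q_def powr_diff powr_minus_divide power_divide)
  finally have shell: "(\<Sum>r\<in>?shell. freq_size r powr (- 2 * s)) \<le> 16 * q ^ k" .
  have "(\<Sum>r | freq_size r < 2 ^ Suc k. freq_size r powr (- 2 * s))
      = (\<Sum>r | freq_size r < 2 ^ k. freq_size r powr (- 2 * s)) + (\<Sum>r\<in>?shell. freq_size r powr (- 2 * s))"
    unfolding split by (intro sum.union_disjoint finite_low_frequencies fin) auto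
  also have "\<dots> \<le> 16 / (q - 1) * q ^ k + 16 * q ^ k"
    using Suc shell by linarith
  also have "\<dots> = 16 / (q - 1) * q ^ Suc k"
    using q1 by (simp add: field_simps)
  finally show ?case .
qed

text \<open>A Bernstein-type bound: a trigonometric sum with frequencies below \<open>2\<^sup>k\<close> and \<open>H\<^sup>s\<close> norm at
  most \<open>1\<close> is pointwise at most a constant times \<open>2\<^sup>k\<^sup>(\<^sup>1\<^sup>-\<^sup>s\<^sup>)\<close>.\<close>
lemma norm_trig_sum_low_le:
  fixes s :: real
  assumes s: "0 \<le> s" "s < 1"
    and R: "finite R" "\<And>r. r \<in> R \<Longrightarrow> freq_size r < 2 ^ k"
    and c: "(\<Sum>r\<in>R. freq_size r powr (2 * s) * (cmod (c r))\<^sup>2) \<le> 1"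
  shows "cmod (trig_sum R c x) \<le> sqrt (16 / (4 powr (1 - s) - 1) * (4 powr (1 - s)) ^ k)"
proof -
  have m0: "freq_size r > 0" for r using freq_size_ge_1[of r] by linarith
  have "cmod (trig_sum R c x) \<le> (\<Sum>r\<in>R. cmod (c r * cis (2 * pi * freq_dot r x)))"
    unfolding trig_sum_def by (rule norm_sum)
  also have "\<dots> = (\<Sum>r\<in>R. (freq_size r powr s * cmod (c r)) * freq_size r powr (- s))"
  proof (intro sum.cong refl)
    fix r
    have "freq_size r powr s * freq_size r powr (- s) = 1"
      using m0[of r] by (simp flip: powr_add)
    then show "cmod (c r * cis (2 * pi * freq_dot r x))
        = (freq_size r powr s * cmod (c r)) * freq_size r powr (- s)"
      by (simp add: norm_mult mult_ac)
  qed
  finally have 1: "cmod (trig_sum R c x) \<le> (\<Sum>r\<in>R. (freq_size r powr s * cmod (c r)) * freq_size r powr (- s))" .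
  have sq: "(freq_size r powr b)\<^sup>2 = freq_size r powr (2 * b)" for r b
    by (simp only: power2_eq_square mult_2 powr_add)
  have "(cmod (trig_sum R c x))\<^sup>2 \<le> (\<Sum>r\<in>R. (freq_size r powr s * cmod (c r)) * freq_size r powr (- s))\<^sup>2"
    by (rule power_mono[OF 1]) simp
  also have "\<dots> \<le> (\<Sum>r\<in>R. (freq_size r powr s * cmod (c r))\<^sup>2) * (\<Sum>r\<in>R. (freq_size r powr (- s))\<^sup>2)"
    by (rule Cauchy_Schwarz_ineq_sum)
  also have "\<dots> = (\<Sum>r\<in>R. freq_size r powr (2 * s) * (cmod (c r))\<^sup>2) * (\<Sum>r\<in>R. freq_size r powr (- 2 * s))"
    by (simp add: power_mult_distrib sq)
  also have "\<dots> \<le> 1 * (\<Sum>r\<in>R. freq_size r powr (- 2 * s))"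
    by (intro mult_right_mono c sum_nonneg) simp
  also have "\<dots> \<le> (\<Sum>r | freq_size r < 2 ^ k. freq_size r powr (- 2 * s))"
    using R by simp (intro sum_mono2 finite_low_frequencies; auto)
  also have "\<dots> \<le> 16 / (4 powr (1 - s) - 1) * (4 powr (1 - s)) ^ k"
    by (rule sum_low_frequencies_le[OF s])
  finally show ?thesis by (rule real_le_rsqrt)
qed

lemma sum_geometric_below_le:
  fixes s m :: real
  assumes "s > 0" "m \<ge> 1"
  defines "g \<equiv> 4 powr s"
  shows "(\<Sum>k<n. if 2 ^ k \<le> m then g ^ k else 0) \<le> g / (g - 1) * m powr (2 * s)"
proof (induction n)
  case 0
  have "g > 1" unfolding g_def using assms by simp
  then show ?case by simp
next
  case (Suc n)
  have g1: "g > 1" unfolding g_def using assms by simp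
  show ?case
  proof (cases "2 ^ n \<le> m")
    case False
    then show ?thesis using Suc by simp
  next
    case True
    have "(\<Sum>k<Suc n. if 2 ^ k \<le> m then g ^ k else 0) \<le> (\<Sum>k<Suc n. g ^ k)"
      using g1 by (intro sum_mono) auto
    also have "\<dots> = (g ^ Suc n - 1) / (g - 1)"
      using g1 by (simp only: sum_gp_strict) (simp add: field_simps)
    also have "\<dots> \<le> g / (g - 1) * g ^ n"
      using g1 by (simp add: divide_right_mono)
    also have "g ^ n = (2 ^ n) powr (2 * s)"
      unfolding g_def by (rule two_power_powr[symmetric])
    also have "g / (g - 1) * (2 ^ n) powr (2 * s) \<le> g / (g - 1) * m powr (2 * s)"
      using g1 True assms(1,2) by (intro mult_left_mono powr_mono2) auto
    finally show ?thesis .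
  qed
qed

text \<open>The pointwise form of the Chemin--Xu argument. Here \<open>B k\<close> bounds the low part of a value
  \<open>U\<close> at level \<open>k\<close> and \<open>H k\<close> is its high part. At the first level \<open>j\<close> with
  \<open>U \<le> 2 B (j + 1)\<close> the low part cannot account for more than half of \<open>U\<close>, so
  \<open>U \<le> 2 H j\<close> (for \<open>j = 0\<close> there is no low part, and \<open>U \<le> H 0\<close> is assumed); two of the
  \<open>p\<close> factors of \<open>U\<close> are estimated by \<open>2 H j\<close> and the remaining \<open>p - 2\<close> by \<open>2 B (j + 1)\<close>. Summing over all levels removes the dependence on \<open>j\<close>.\<close>
lemma powr_le_sum_high_parts:
  fixes U :: real and B H :: "nat \<Rightarrow> real"
  assumes p: "p \<ge> 2" and U: "U \<ge> 0" and n: "n > 0"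
    and split: "\<And>k. U \<le> B k + H k" and top: "U \<le> H 0" and bot: "U \<le> B n"
  shows "U powr p \<le> (\<Sum>k<n. 4 * (2 * B (k + 1)) powr (p - 2) * (H k)\<^sup>2)"
proof -
  define P where "P j \<longleftrightarrow> U \<le> 2 * B (j + 1)" for j
  define j where "j = (LEAST j. P j)"
  have Pn: "P (n - 1)"
    using n U bot by (simp add: P_def)
  have Pj: "P j" unfolding j_def by (rule LeastI[of P, OF Pn])
  have "j \<le> n - 1" unfolding j_def by (rule Least_le[of P, OF Pn])
  then have jn: "j < n" using n by linarith
  have U2: "U \<le> 2 * H j"
  proof (cases j)
    case 0
    then show ?thesis using top U by simp
  next
    case (Suc i)
    then have "\<not> P i" using not_less_Least[of i P] unfolding j_def by simp
    then have "2 * B j < U" by (simp add: P_def Suc)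
    then show ?thesis using split[of j] by linarith
  qed
  have "U powr p = U powr (p - 2) * U\<^sup>2"
  proof (cases "U = 0")
    case False
    then have "U powr 2 = U\<^sup>2" using U by simp
    then show ?thesis using powr_add[of U "p - 2" 2] by simp
  qed simp
  also have "\<dots> \<le> (2 * B (j + 1)) powr (p - 2) * (2 * H j)\<^sup>2"
    using Pj p U U2 by (intro mult_mono powr_mono2 power_mono) (auto simp: P_def)
  also have "\<dots> = 4 * (2 * B (j + 1)) powr (p - 2) * (H j)\<^sup>2"
    by (simp add: power_mult_distrib)
  also have "\<dots> \<le> (\<Sum>k<n. 4 * (2 * B (k + 1)) powr (p - 2) * (H k)\<^sup>2)"
    using jn by (intro member_le_sum[of j "{..<n}" "\<lambda>k. 4 * (2 * B (k + 1)) powr (p - 2) * (H k)\<^sup>2"]) auto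
  finally show ?thesis .
qed

text \<open>The embedding of \<open>H\<^sup>s\<close> into \<open>L\<^sup>p\<close> on the grid at the critical exponent
  \<open>p = 2 / (1 - s)\<close>, with a constant that depends on \<open>p\<close> only. It is the equality
  \<open>(1 - s) (p - 2) = 2 s\<close> that turns the low-frequency bounds at level \<open>k\<close> into exactly
  \<open>4\<^sup>s\<^sup>k\<close>, whose sum over \<open>2\<^sup>k \<le> freq_size r\<close> is comparable to the Sobolev weight.\<close>
lemma critical_sobolev_trig_sum:
  fixes p :: real
  assumes N: "N \<in> grid_sizes" and p: "p > 2"
  defines "s \<equiv> 1 - 2 / p"
  defines "D \<equiv> 16 / (4 powr (1 - s) - 1)" and "g \<equiv> 4 powr s"
  assumes c: "(\<Sum>r\<in>frequencies N. freq_size r powr (2 * s) * (cmod (c r))\<^sup>2) \<le> 1"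
  shows "(mesh N)\<^sup>2 * (\<Sum>m\<in>grid_indices N. cmod (trig_sum (frequencies N) c (grid_point N m)) powr p)
    \<le> 4 * (2 * sqrt D) powr (p - 2) * g * (g / (g - 1))"
proof -
  define q where "q = (4::real) powr (1 - s)"
  have s: "0 < s" "s < 1" using p by (auto simp: s_def)
  have q1: "q > 1" and g1: "g > 1" unfolding q_def g_def using s by auto
  have D0: "D > 0" using q1 by (simp add: D_def q_def)
  let ?F = "frequencies N"
  define low where "low k = {r \<in> ?F. freq_size r < 2 ^ k}" for k
  define high where "high k = {r \<in> ?F. 2 ^ k \<le> freq_size r}" for k
  define B where "B k = sqrt (D * q ^ k)" for k
  define A where "A = 4 * (2 * sqrt D) powr (p - 2) * g"
  have A0: "A \<ge> 0" using g1 by (simp add: A_def)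
  have low_le: "cmod (trig_sum (low k) c x) \<le> B k" for k x
  proof -
    have "(\<Sum>r\<in>low k. freq_size r powr (2 * s) * (cmod (c r))\<^sup>2)
        \<le> (\<Sum>r\<in>?F. freq_size r powr (2 * s) * (cmod (c r))\<^sup>2)"
      by (intro sum_mono2) (auto simp: low_def)
    with c have "(\<Sum>r\<in>low k. freq_size r powr (2 * s) * (cmod (c r))\<^sup>2) \<le> 1" by linarith
    then show ?thesis
      unfolding B_def D_def q_def using s by (intro norm_trig_sum_low_le) (auto simp: low_def)
  qed
  have split: "trig_sum ?F c x = trig_sum (low k) c x + trig_sum (high k) c x" for k x
  proof -
    have "?F = low k \<union> high k" by (auto simp: low_def high_def)
    moreover have "low k \<inter> high k = {}" by (auto simp: low_def high_def)
    moreover have "finite (low k)" "finite (high k)" by (auto simp: low_def high_def)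
    ultimately show ?thesis
      unfolding trig_sum_def by (simp only: sum.union_disjoint)
  qed
  have high0: "high 0 = ?F"
    using freq_size_ge_1 by (auto simp: high_def)
  \<comment> \<open>Any level beyond the largest frequency would do.\<close>
  obtain n where n: "n > 0" "low n = ?F"
  proof
    show "N > 0" using N by (auto simp: grid_sizes_def)
    have "real N < 2 ^ N" by (rule of_nat_less_two_power)
    moreover have "freq_size r \<le> real N" if "r \<in> ?F" for r
      using that N by (auto simp: freq_size_def frequencies_def Let_def grid_sizes_def)
    ultimately have "freq_size r < 2 ^ N" if "r \<in> ?F" for r
      using that le_less_trans by blast
    then show "low N = ?F" by (auto simp: low_def)
  qed
  have weight: "4 * (2 * B (k + 1)) powr (p - 2) = A * g ^ k" for k
  proof -
    have "q powr ((p - 2) / 2) = g"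
    proof -
      have "(1 - s) * ((p - 2) / 2) = s" using p by (simp add: s_def field_simps)
      then show ?thesis by (simp add: q_def g_def powr_powr)
    qed
    moreover have "sqrt (q ^ (k + 1)) powr (p - 2) = (q powr ((p - 2) / 2)) ^ (k + 1)"
    proof -
      have "sqrt (q ^ (k + 1)) = (q powr real (k + 1)) powr (1 / 2)"
      proof -
        have "q powr real (k + 1) = q ^ (k + 1)"
          using q1 by (intro powr_realpow) simp
        moreover have "(q ^ (k + 1)) powr (1 / 2) = sqrt (q ^ (k + 1))"
          using q1 by (intro powr_half_sqrt) simp
        ultimately show ?thesis by (simp only:)
      qed
      then have "sqrt (q ^ (k + 1)) powr (p - 2) = q powr (real (k + 1) * (1 / 2) * (p - 2))"
        by (simp only: powr_powr)
      also have "\<dots> = (q powr ((p - 2) / 2)) powr real (k + 1)"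
        by (simp add: powr_powr mult_ac)
      also have "\<dots> = (q powr ((p - 2) / 2)) ^ (k + 1)"
        using q1 by (intro powr_realpow) simp
      finally show ?thesis .
    qed
    moreover have "2 * B (k + 1) = (2 * sqrt D) * sqrt (q ^ (k + 1))"
      by (simp add: B_def real_sqrt_mult)
    ultimately show ?thesis
      using D0 q1 by (simp add: A_def powr_mult del: real_sqrt_eq_iff)
  qed
  have pointwise: "cmod (trig_sum ?F c x) powr p
      \<le> (\<Sum>k<n. A * g ^ k * (cmod (trig_sum (high k) c x))\<^sup>2)" for x
  proof -
    have "cmod (trig_sum ?F c x) powr p
      \<le> (\<Sum>k<n. 4 * (2 * B (k + 1)) powr (p - 2) * (cmod (trig_sum (high k) c x))\<^sup>2)"
    proof (rule powr_le_sum_high_parts)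
      show "cmod (trig_sum ?F c x) \<le> B k + cmod (trig_sum (high k) c x)" for k
        using norm_triangle_ineq[of "trig_sum (low k) c x" "trig_sum (high k) c x"] low_le[of k x]
        by (simp only: split[of x k])
      show "cmod (trig_sum ?F c x) \<le> B n"
        using low_le[of n x] n by simp
    qed (use p n high0 in auto)
    then show ?thesis by (simp only: weight)
  qed
  have "(mesh N)\<^sup>2 * (\<Sum>m\<in>grid_indices N. cmod (trig_sum ?F c (grid_point N m)) powr p)
      \<le> (mesh N)\<^sup>2 * (\<Sum>m\<in>grid_indices N. \<Sum>k<n. A * g ^ k * (cmod (trig_sum (high k) c (grid_point N m)))\<^sup>2)"
    by (intro mult_left_mono sum_mono pointwise) simp
  also have "\<dots> = (\<Sum>k<n. A * g ^ k *
      ((mesh N)\<^sup>2 * (\<Sum>m\<in>grid_indices N. (cmod (trig_sum (high k) c (grid_point N m)))\<^sup>2)))"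
    by (subst sum.swap) (simp add: sum_distrib_left mult_ac)
  also have "\<dots> = (\<Sum>k<n. A * g ^ k * (\<Sum>r\<in>high k. (cmod (c r))\<^sup>2))"
    by (intro sum.cong refl) (subst parseval[OF N], auto simp: high_def)
  also have "\<dots> = (\<Sum>k<n. \<Sum>r\<in>?F. A * ((if 2 ^ k \<le> freq_size r then g ^ k else 0) * (cmod (c r))\<^sup>2))"
    unfolding high_def sum.inter_filter[OF finite_frequencies] sum_distrib_left
    by (intro sum.cong refl) auto
  also have "\<dots> = A * (\<Sum>r\<in>?F. (\<Sum>k<n. if 2 ^ k \<le> freq_size r then g ^ k else 0) * (cmod (c r))\<^sup>2)"
    by (subst sum.swap) (simp only: sum_distrib_left sum_distrib_right)
  also have "\<dots> \<le> A * (\<Sum>r\<in>?F. (g / (g - 1) * freq_size r powr (2 * s)) * (cmod (c r))\<^sup>2)"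
    using s freq_size_ge_1 unfolding g_def
    by (intro mult_left_mono sum_mono mult_right_mono sum_geometric_below_le)
       (auto intro: A0)
  also have "\<dots> = A * (g / (g - 1)) * (\<Sum>r\<in>?F. freq_size r powr (2 * s) * (cmod (c r))\<^sup>2)"
    by (simp add: sum_distrib_left mult_ac)
  also have "\<dots> \<le> A * (g / (g - 1)) * 1"
    using A0 g1 c by (intro mult_left_mono) auto
  finally show ?thesis by (simp add: A_def)
qed

lemma norm_L_squared_fourier:
  assumes N: "N \<in> grid_sizes" and "\<nu> > 0"
  shows "(norm_L N \<alpha> \<nu> w)\<^sup>2
    = (\<Sum>r\<in>frequencies N. (\<nu> + symbol r powr \<alpha>) * (cmod (dft N w r))\<^sup>2)"
  unfolding norm_L_squared[OF assms(2)] inner_N_frac_laplacian[OF N] inner_N_self[OF N, of w]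
  by (simp add: sum_distrib_left sum.distrib distrib_right mult.assoc)

lemma freq_size_powr_le:
  assumes "0 \<le> s" "s \<le> \<alpha>"
  shows "freq_size r powr (2 * s) \<le> 1 + symbol r powr \<alpha>"
proof (cases "freq_size r = 1")
  case False
  then have max1: "freq_size r > 1" "freq_size r = max \<bar>real_of_int (fst r)\<bar> \<bar>real_of_int (snd r)\<bar>"
    using freq_size_ge_1[of r] by (auto simp: freq_size_def max_def split: if_splits)
  have "(freq_size r)\<^sup>2 \<le> (real_of_int (fst r))\<^sup>2 + (real_of_int (snd r))\<^sup>2"
    unfolding max1(2) by (auto simp: max_def)
  also have "\<dots> \<le> symbol r"
  proof -
    have "1 \<le> 4 * pi\<^sup>2"
      using pi_ge_two power_mono[of 2 pi 2] by simp
    then have "1 * ((real_of_int (fst r))\<^sup>2 + (real_of_int (snd r))\<^sup>2) \<le> symbol r"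
      unfolding symbol_def by (intro mult_right_mono) auto
    then show ?thesis by simp
  qed
  finally have le: "(freq_size r)\<^sup>2 \<le> symbol r" .
  have sq: "(freq_size r)\<^sup>2 = freq_size r powr 2" using max1 by simp
  have "freq_size r powr (2 * s) \<le> freq_size r powr (2 * \<alpha>)"
    using assms max1 by (intro powr_mono) auto
  also have "\<dots> = ((freq_size r)\<^sup>2) powr \<alpha>"
    by (simp only: sq powr_powr)
  also have "\<dots> \<le> symbol r powr \<alpha>"
    using le assms by (intro powr_mono2) auto
  finally show ?thesis by simp
qed simp

text \<open>The condition \<open>1 - 2 / p \<le> \<alpha>\<close> says that \<open>\<alpha>\<close> is at least the order \<open>s\<close> for which \<open>p\<close>
  is critical, so subcritical exponents reduce to the critical case by lowering the order.
  The case \<open>p = 2\<close>, where \<open>s = 0\<close> and the geometric sums degenerate, is immediate.\<close>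
lemma discrete_sobolev:
  fixes \<alpha> p \<nu> :: real
  assumes p: "p \<ge> 2" and exponent: "1 - 2 / p \<le> \<alpha>" and \<nu>: "\<nu> > 0"
  shows "\<exists>C\<ge>0. \<forall>N\<in>grid_sizes. \<forall>w. norm_L N \<alpha> \<nu> w \<le> 1 \<longrightarrow>
    (mesh N)\<^sup>2 * (\<Sum>m\<in>grid_indices N. \<bar>w (grid_point N m)\<bar> powr p) \<le> C"
proof -
  have norm1: "(norm_L N \<alpha> \<nu> w)\<^sup>2 \<le> 1" if "norm_L N \<alpha> \<nu> w \<le> 1" for N w
  proof -
    have "0 \<le> norm_L N \<alpha> \<nu> w"
      using \<nu> by (simp add: norm_L_def inner_L_def inner_N_self_nonneg)
    then show ?thesis using that by (simp add: power_le_one)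
  qed
  show ?thesis
  proof (cases "p = 2")
    case True
    have "(mesh N)\<^sup>2 * (\<Sum>m\<in>grid_indices N. \<bar>w (grid_point N m)\<bar> powr p) \<le> 1 / \<nu>"
      if "norm_L N \<alpha> \<nu> w \<le> 1" for N w
    proof -
      have "\<nu> * inner_N N w w \<le> 1"
        using norm1[OF that] norm_L_squared[OF \<nu>, of N \<alpha> w]
          inner_N_self_nonneg[of N "frac_laplacian N (\<alpha> / 2) w"] by linarith
      moreover have "(mesh N)\<^sup>2 * (\<Sum>m\<in>grid_indices N. \<bar>w (grid_point N m)\<bar> powr p) = inner_N N w w"
        by (simp add: True inner_N_def flip: power2_eq_square)
      ultimately show ?thesis using \<nu> by (simp add: field_simps)
    qed
    then show ?thesis using \<nu> by (intro exI[of _ "1 / \<nu>"]) auto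
  next
    case False
    with p have p2: "p > 2" by simp
    define s where "s = 1 - 2 / p"
    have s: "0 \<le> s" "s \<le> \<alpha>" using p2 exponent by (auto simp: s_def)
    \<comment> \<open>The constant with which the squared \<open>\<L>\<^sub>N\<close>-norm controls the squared \<open>H\<^sup>s\<close> norm.\<close>
    define \<kappa> where "\<kappa> = max 1 (1 / \<nu>)"
    have \<kappa>: "\<kappa> \<ge> 1" "\<kappa> * \<nu> \<ge> 1"
      using \<nu> by (auto simp: \<kappa>_def max_def field_simps)
    obtain C where C: "\<And>N c. N \<in> grid_sizes \<Longrightarrow>
        (\<Sum>r\<in>frequencies N. freq_size r powr (2 * s) * (cmod (c r))\<^sup>2) \<le> 1 \<Longrightarrow>
        (mesh N)\<^sup>2 * (\<Sum>m\<in>grid_indices N. cmod (trig_sum (frequencies N) c (grid_point N m)) powr p) \<le> C"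
      using critical_sobolev_trig_sum[OF _ p2, folded s_def] by blast
    have "(mesh N)\<^sup>2 * (\<Sum>m\<in>grid_indices N. \<bar>w (grid_point N m)\<bar> powr p) \<le> sqrt \<kappa> powr p * C"
      if N: "N \<in> grid_sizes" and w: "norm_L N \<alpha> \<nu> w \<le> 1" for N w
    proof -
      define c where "c r = of_real (1 / sqrt \<kappa>) * dft N w r" for r
      have "(\<Sum>r\<in>frequencies N. freq_size r powr (2 * s) * (cmod (c r))\<^sup>2)
          = (\<Sum>r\<in>frequencies N. freq_size r powr (2 * s) * (cmod (dft N w r))\<^sup>2) / \<kappa>"
        using \<kappa> by (simp add: c_def norm_mult norm_divide power_mult_distrib power_divide sum_divide_distrib)
      also have "\<dots> \<le> (\<Sum>r\<in>frequencies N. (\<kappa> * (\<nu> + symbol r powr \<alpha>)) * (cmod (dft N w r))\<^sup>2) / \<kappa>"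
      proof (intro divide_right_mono sum_mono mult_right_mono)
        fix r
        have "1 * symbol r powr \<alpha> \<le> \<kappa> * symbol r powr \<alpha>"
          using \<kappa> by (intro mult_right_mono) auto
        then show "freq_size r powr (2 * s) \<le> \<kappa> * (\<nu> + symbol r powr \<alpha>)"
          using freq_size_powr_le[OF s, of r] \<kappa> by (simp add: distrib_left)
      qed (use \<kappa> in auto)
      also have "\<dots> = (norm_L N \<alpha> \<nu> w)\<^sup>2"
        using \<kappa> by (simp add: norm_L_squared_fourier[OF N \<nu>] mult.assoc flip: sum_distrib_left)
      also have "\<dots> \<le> 1" by (rule norm1[OF w])
      finally have "(mesh N)\<^sup>2 * (\<Sum>m\<in>grid_indices N.
          cmod (trig_sum (frequencies N) c (grid_point N m)) powr p) \<le> C"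
        by (rule C[OF N])
      moreover have "\<bar>w (grid_point N m)\<bar> powr p
          = sqrt \<kappa> powr p * cmod (trig_sum (frequencies N) c (grid_point N m)) powr p"
        if m: "m \<in> grid_indices N" for m
      proof -
        have "trig_sum (frequencies N) c (grid_point N m)
            = of_real (1 / sqrt \<kappa>) * trig_sum (frequencies N) (dft N w) (grid_point N m)"
          by (simp add: trig_sum_def c_def sum_distrib_left mult.assoc)
        then have "\<bar>w (grid_point N m)\<bar> = sqrt \<kappa> * cmod (trig_sum (frequencies N) c (grid_point N m))"
          using \<kappa> by (simp add: dft_inversion[OF N m] norm_mult norm_divide)
        then show ?thesis using \<kappa> by (simp add: powr_mult)
      qed
      then have eq: "(mesh N)\<^sup>2 * (\<Sum>m\<in>grid_indices N. \<bar>w (grid_point N m)\<bar> powr p)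
        = sqrt \<kappa> powr p * ((mesh N)\<^sup>2 *
          (\<Sum>m\<in>grid_indices N. cmod (trig_sum (frequencies N) c (grid_point N m)) powr p))"
        by (simp add: mult.left_commute flip: sum_distrib_left)
      ultimately show ?thesis
        unfolding eq by (intro mult_left_mono) auto
    qed
    then show ?thesis
      by (intro exI[of _ "max 0 (sqrt \<kappa> powr p * C)"]) (auto simp: le_max_iff_disj)
  qed
qed

section \<open>The power nonlinearity\<close>

lemma has_real_derivative_abs_powr:
  fixes a p :: real
  assumes p: "p > 1"
  shows "((\<lambda>x. \<bar>x\<bar> powr p) has_real_derivative p * (sgn a * \<bar>a\<bar> powr (p - 1))) (at a)"
proof -
  consider "a > 0" | "a < 0" | "a = 0" by linarith
  then show ?thesis
  proof cases
    case 1
    have "((\<lambda>x. x powr p) has_real_derivative p * a powr (p - 1)) (at a)"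
      by (rule has_real_derivative_powr[OF 1])
    then have "((\<lambda>x. \<bar>x\<bar> powr p) has_real_derivative p * a powr (p - 1)) (at a)"
      by (rule has_field_derivative_transform_within_open[of _ _ _ "{0<..}"]) (use 1 in auto)
    then show ?thesis using 1 by simp
  next
    case 2
    have "((\<lambda>x. (- x) powr p) has_real_derivative p * (- a) powr (p - 1) * (- 1)) (at a)"
      by (rule DERIV_chain2[where f = "\<lambda>x. x powr p"])
        (use 2 in \<open>auto intro!: has_real_derivative_powr derivative_eq_intros\<close>)
    then have "((\<lambda>x. \<bar>x\<bar> powr p) has_real_derivative p * (- a) powr (p - 1) * (- 1)) (at a)"
      by (rule has_field_derivative_transform_within_open[of _ _ _ "{..<0}"]) (use 2 in auto)
    then show ?thesis using 2 by simp
  next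
    case 3
    have "((\<lambda>h::real. \<bar>h\<bar> powr (p - 1)) \<longlongrightarrow> \<bar>0\<bar> powr (p - 1)) (at 0)"
      using p by (intro tendsto_powr' tendsto_intros) auto
    then have lim: "((\<lambda>h::real. \<bar>h\<bar> powr (p - 1)) \<longlongrightarrow> 0) (at 0)"
      using p by simp
    have "((\<lambda>h::real. \<bar>h\<bar> powr p / h) \<longlongrightarrow> 0) (at 0)"
    proof (rule Lim_null_comparison[OF _ lim])
      show "\<forall>\<^sub>F h in at (0::real). norm (\<bar>h\<bar> powr p / h) \<le> \<bar>h\<bar> powr (p - 1)"
        by (auto simp: eventually_at_filter powr_diff)
    qed
    then show ?thesis using 3 by (simp add: DERIV_def)
  qed
qed

text \<open>The map \<open>a \<mapsto> |a|\<^sup>p\<^sup>-\<^sup>2 a\<close>, the derivative of \<open>a \<mapsto> |a|\<^sup>p / p\<close>. Writing it with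
  \<open>sgn\<close> keeps it total and continuous at \<open>0\<close>.\<close>
definition power_map :: "real \<Rightarrow> real \<Rightarrow> real" where
  "power_map p a = sgn a * \<bar>a\<bar> powr (p - 1)"

lemma power_map_minus: "power_map p (- a) = - power_map p a"
  by (simp add: power_map_def sgn_minus)

lemma power_map_diff_nonneg_args:
  assumes p: "p \<ge> 2" and "0 \<le> b" "b < a"
  shows "0 \<le> power_map p a - power_map p b"
    and "power_map p a - power_map p b \<le> (p - 1) * a powr (p - 2) * (a - b)"
proof -
  have pm: "power_map p x = x powr (p - 1)" if "x \<ge> 0" for x
    using that by (simp add: power_map_def sgn_if)
  show "0 \<le> power_map p a - power_map p b"
    using assms by (simp add: pm powr_mono2)
  show "power_map p a - power_map p b \<le> (p - 1) * a powr (p - 2) * (a - b)"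
  proof (cases "b = 0")
    case True
    have "a powr (p - 1) = a powr (p - 2) * a"
      using powr_add[of a "p - 2" 1] assms by simp
    moreover have "1 * (a powr (p - 2) * a) \<le> (p - 1) * (a powr (p - 2) * a)"
      using assms by (intro mult_right_mono) auto
    ultimately show ?thesis using True assms by (simp add: pm)
  next
    case False
    \<comment> \<open>The mean value theorem is applied only for \<open>b > 0\<close>, where the power is differentiable on
      the whole closed interval.\<close>
    have "\<exists>z>b. z < a \<and> a powr (p - 1) - b powr (p - 1) = (a - b) * ((p - 1) * z powr (p - 1 - 1))"
      by (rule MVT2[OF \<open>b < a\<close>]) (rule has_real_derivative_powr, use False assms in auto)
    then obtain z where z: "b < z" "z < a"
      "a powr (p - 1) - b powr (p - 1) = (a - b) * ((p - 1) * z powr (p - 2))"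
      by auto
    have "z powr (p - 2) \<le> a powr (p - 2)"
      using z assms by (intro powr_mono2) auto
    then have "(a - b) * ((p - 1) * z powr (p - 2)) \<le> (a - b) * ((p - 1) * a powr (p - 2))"
      using assms by (intro mult_left_mono) auto
    then show ?thesis using z assms by (simp add: pm mult_ac)
  qed
qed

lemma power_map_diff_less:
  assumes p: "p \<ge> 2" and ab: "b < a"
  shows "0 \<le> power_map p a - power_map p b"
    and "power_map p a - power_map p b \<le> (p - 1) * max \<bar>a\<bar> \<bar>b\<bar> powr (p - 2) * (a - b)"
proof -
  have "0 \<le> power_map p a - power_map p b \<and>
    power_map p a - power_map p b \<le> (p - 1) * max \<bar>a\<bar> \<bar>b\<bar> powr (p - 2) * (a - b)"
  proof -
    consider "b \<ge> 0" | "a \<le> 0" | "b < 0" "0 < a" by linarith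
    then show ?thesis
    proof cases
      case 1
      then show ?thesis
        using power_map_diff_nonneg_args[OF p 1 ab] ab by (simp add: max_def)
    next
      case 2
      then have "0 \<le> - a" "- a < - b" using ab by auto
      from power_map_diff_nonneg_args[OF p this] show ?thesis
        using 2 ab by (simp add: power_map_minus max_def)
    next
      case 3
      let ?M = "max \<bar>a\<bar> \<bar>b\<bar>"
      have part: "\<bar>x\<bar> powr (p - 1) \<le> ?M powr (p - 2) * \<bar>x\<bar>" if "\<bar>x\<bar> \<le> ?M" "x \<noteq> 0" for x
      proof -
        have "\<bar>x\<bar> powr (p - 1) = \<bar>x\<bar> powr (p - 2) * \<bar>x\<bar>"
          using powr_add[of "\<bar>x\<bar>" "p - 2" 1] that by simp
        also have "\<dots> \<le> ?M powr (p - 2) * \<bar>x\<bar>"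
          using that p by (intro mult_right_mono powr_mono2) auto
        finally show ?thesis .
      qed
      have eq: "power_map p a - power_map p b = \<bar>a\<bar> powr (p - 1) + \<bar>b\<bar> powr (p - 1)"
        using 3 by (simp add: power_map_def)
      also have "\<dots> \<le> ?M powr (p - 2) * \<bar>a\<bar> + ?M powr (p - 2) * \<bar>b\<bar>"
        using 3 by (intro add_mono part) auto
      also have "\<dots> = 1 * (?M powr (p - 2) * (a - b))"
        using 3 by (simp add: algebra_simps)
      also have "\<dots> \<le> (p - 1) * (?M powr (p - 2) * (a - b))"
        using p ab by (intro mult_right_mono) auto
      finally show ?thesis unfolding eq by (simp add: mult.assoc)
    qed
  qed
  then show "0 \<le> power_map p a - power_map p b"
    and "power_map p a - power_map p b \<le> (p - 1) * max \<bar>a\<bar> \<bar>b\<bar> powr (p - 2) * (a - b)"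
    by auto
qed

lemma power_map_monotone:
  assumes p: "p \<ge> 2"
  shows "0 \<le> (power_map p a - power_map p b) * (a - b)"
    and "(power_map p a - power_map p b) * (a - b) \<le> (p - 1) * (max \<bar>a\<bar> \<bar>b\<bar> powr (p - 2) * (a - b)\<^sup>2)"
proof -
  have less: "0 \<le> (power_map p x - power_map p y) * (x - y) \<and>
      (power_map p x - power_map p y) * (x - y) \<le> (p - 1) * (max \<bar>x\<bar> \<bar>y\<bar> powr (p - 2) * (x - y)\<^sup>2)"
    if "y < x" for x y
    using power_map_diff_less[OF p that] that
      mult_right_mono[OF power_map_diff_less(2)[OF p that], of "x - y"]
    by (simp add: power2_eq_square mult.assoc)
  have "0 \<le> (power_map p a - power_map p b) * (a - b) \<and>
      (power_map p a - power_map p b) * (a - b) \<le> (p - 1) * (max \<bar>a\<bar> \<bar>b\<bar> powr (p - 2) * (a - b)\<^sup>2)"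
  proof (cases a b rule: linorder_cases)
    case less
    have "(power_map p a - power_map p b) * (a - b) = (power_map p b - power_map p a) * (b - a)"
      by (simp add: algebra_simps)
    then show ?thesis
      using \<open>\<And>x y. y < x \<Longrightarrow> _\<close>[OF less] by (simp only: max.commute power2_commute[of b a])
  qed (use less in auto)
  then show "0 \<le> (power_map p a - power_map p b) * (a - b)"
    and "(power_map p a - power_map p b) * (a - b) \<le> (p - 1) * (max \<bar>a\<bar> \<bar>b\<bar> powr (p - 2) * (a - b)\<^sup>2)"
    by auto
qed

text \<open>A crude Young inequality; applied to normalised functions it replaces the Hoelder
  inequality with exponents \<open>p / (p - 2)\<close> and \<open>p / 2\<close>.\<close>
lemma powr_mult_square_le:
  fixes x y :: real
  assumes p: "p \<ge> 2" and "0 \<le> x" "0 \<le> y"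
  shows "x powr (p - 2) * y\<^sup>2 \<le> x powr p + y powr p"
proof -
  have sq: "z powr (p - 2) * z\<^sup>2 = z powr p" if "z \<ge> 0" for z
  proof (cases "z = 0")
    case False
    then show ?thesis using powr_add[of z "p - 2" 2] that by simp
  qed simp
  show ?thesis
  proof (cases "x \<le> y")
    case True
    then have "x powr (p - 2) * y\<^sup>2 \<le> y powr (p - 2) * y\<^sup>2"
      using assms by (intro mult_right_mono powr_mono2) auto
    then show ?thesis using sq[of y] assms by (simp add: add_increasing)
  next
    case False
    then have "x powr (p - 2) * y\<^sup>2 \<le> x powr (p - 2) * x\<^sup>2"
      using assms by (intro mult_left_mono power_mono) auto
    then show ?thesis using sq[of x] assms by (simp add: add_increasing2)
  qed
qed

section \<open>Linearity of the discrete operators\<close>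

lemma inner_N_affine:
  "inner_N N (\<lambda>x. a x + s * b x) (\<lambda>x. a x + s * b x)
    = inner_N N a a + 2 * s * inner_N N a b + s\<^sup>2 * inner_N N b b"
  by (simp add: inner_N_def sum_distrib_left sum.distrib[symmetric] power2_eq_square algebra_simps)

lemma inner_N_affine_right:
  "inner_N N a (\<lambda>x. b x + s * c x) = inner_N N a b + s * inner_N N a c"
  by (simp add: inner_N_def sum_distrib_left sum.distrib[symmetric] algebra_simps)

lemma dft_affine: "dft N (\<lambda>x. a x + s * b x) r = dft N a r + of_real s * dft N b r"
  by (simp add: dft_def sum_distrib_left sum.distrib[symmetric] algebra_simps)

lemma frac_laplacian_affine:
  "frac_laplacian N \<beta> (\<lambda>x. a x + s * b x) = (\<lambda>x. frac_laplacian N \<beta> a x + s * frac_laplacian N \<beta> b x)"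
proof
  fix x
  have "frac_laplacian_sum N \<beta> (\<lambda>x. a x + s * b x) x
      = frac_laplacian_sum N \<beta> a x + of_real s * frac_laplacian_sum N \<beta> b x"
    by (simp add: frac_laplacian_sum_def dft_affine sum_distrib_left sum.distrib[symmetric] algebra_simps)
  then show "frac_laplacian N \<beta> (\<lambda>x. a x + s * b x) x = frac_laplacian N \<beta> a x + s * frac_laplacian N \<beta> b x"
    by (simp add: frac_laplacian_def)
qed

lemma frac_laplacian_diff:
  "frac_laplacian N \<beta> (\<lambda>x. a x - b x) = (\<lambda>x. frac_laplacian N \<beta> a x - frac_laplacian N \<beta> b x)"
  using frac_laplacian_affine[of N \<beta> a "-1" b] by simp

lemma frac_laplacian_scale:
  "frac_laplacian N \<beta> (\<lambda>x. s * a x) = (\<lambda>x. s * frac_laplacian N \<beta> a x)"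
proof -
  have "frac_laplacian N \<beta> (\<lambda>x. 0) = (\<lambda>x. 0)"
    by (simp add: fun_eq_iff frac_laplacian_def frac_laplacian_sum_def dft_def)
  then show ?thesis
    using frac_laplacian_affine[of N \<beta> "\<lambda>x. 0" s a] by simp
qed

lemma norm_L_nonneg: "\<nu> > 0 \<Longrightarrow> norm_L N \<alpha> \<nu> w \<ge> 0"
  by (simp add: norm_L_def inner_L_def inner_N_self_nonneg)

lemma norm_L_scale: "norm_L N \<alpha> \<nu> (\<lambda>x. s * w x) = \<bar>s\<bar> * norm_L N \<alpha> \<nu> w"
proof -
  have "inner_L N \<alpha> \<nu> (\<lambda>x. s * w x) (\<lambda>x. s * w x) = s\<^sup>2 * inner_L N \<alpha> \<nu> w w"
    by (simp add: inner_L_def frac_laplacian_scale inner_N_def sum_distrib_left power2_eq_square algebra_simps)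
  then show ?thesis by (simp add: norm_L_def real_sqrt_mult)
qed

lemma inner_N_le_norm_L: "\<nu> > 0 \<Longrightarrow> \<nu> * inner_N N w w \<le> (norm_L N \<alpha> \<nu> w)\<^sup>2"
  by (simp add: norm_L_squared inner_N_self_nonneg)

lemma norm_N_2_squared: "(norm_N N 2 w)\<^sup>2 = inner_N N w w"
  by (simp add: norm_N_def inner_N_def powr_half_sqrt sum_nonneg flip: power2_eq_square)

lemma norm_N_powr:
  assumes "p > 0"
  shows "norm_N N p w powr p = (mesh N)\<^sup>2 * (\<Sum>m\<in>grid_indices N. \<bar>w (grid_point N m)\<bar> powr p)"
  using assms by (simp add: norm_N_def powr_powr sum_nonneg)

section \<open>The derivative of the energy\<close>

text \<open>The derivative of the energy at \<open>v\<close> in direction \<open>w\<close>.\<close>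
definition energy_gradient ::
  "nat \<Rightarrow> real \<Rightarrow> real \<Rightarrow> real \<Rightarrow> (real \<times> real \<Rightarrow> real) \<Rightarrow> (real \<times> real \<Rightarrow> real) \<Rightarrow> (real \<times> real \<Rightarrow> real) \<Rightarrow> real" where
  "energy_gradient N \<alpha> p t f v w =
     inner_N N (frac_laplacian N (\<alpha> / 2) v) (frac_laplacian N (\<alpha> / 2) w)
     + inner_N N (\<lambda>x. power_map p (v x)) w + t * inner_N N v w - inner_N N f w"

lemma energy_has_derivative:
  assumes p: "p \<ge> 2"
  shows "((\<lambda>s. energy N \<alpha> p t f (\<lambda>x. v x + s * w x)) has_real_derivative
    energy_gradient N \<alpha> p t f v w) (at 0)"
proof -
  let ?D = "frac_laplacian N (\<alpha> / 2)"
  have "((\<lambda>s. \<bar>v x + s * w x\<bar> powr p) has_real_derivative p * power_map p (v x) * w x) (at 0)" for x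
  proof (rule DERIV_chain2[where f = "\<lambda>y. \<bar>y\<bar> powr p"])
    show "((\<lambda>y. \<bar>y\<bar> powr p) has_real_derivative p * power_map p (v x)) (at (v x + 0 * w x))"
      using has_real_derivative_abs_powr[of p "v x"] p by (simp add: power_map_def)
    show "((\<lambda>s. v x + s * w x) has_real_derivative w x) (at 0)"
      by (auto intro!: derivative_eq_intros)
  qed
  then have "((\<lambda>s. 1 / p * ((mesh N)\<^sup>2 * (\<Sum>m\<in>grid_indices N. \<bar>v (grid_point N m) + s * w (grid_point N m)\<bar> powr p)))
      has_real_derivative 1 / p * ((mesh N)\<^sup>2 * (\<Sum>m\<in>grid_indices N.
        p * power_map p (v (grid_point N m)) * w (grid_point N m)))) (at 0)"
    by (intro DERIV_cmult DERIV_sum)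
  moreover have "1 / p * ((mesh N)\<^sup>2 * (\<Sum>m\<in>grid_indices N.
        p * power_map p (v (grid_point N m)) * w (grid_point N m))) = inner_N N (\<lambda>x. power_map p (v x)) w"
    using p by (simp add: inner_N_def mult.assoc flip: sum_distrib_left)
  ultimately have potential: "((\<lambda>s. 1 / p * ((mesh N)\<^sup>2 * (\<Sum>m\<in>grid_indices N.
        \<bar>v (grid_point N m) + s * w (grid_point N m)\<bar> powr p)))
      has_real_derivative inner_N N (\<lambda>x. power_map p (v x)) w) (at 0)"
    by simp
  have eq: "energy N \<alpha> p t f (\<lambda>x. v x + s * w x)
      = 1 / 2 * (inner_N N (?D v) (?D v) + 2 * s * inner_N N (?D v) (?D w) + s\<^sup>2 * inner_N N (?D w) (?D w))
      + 1 / p * ((mesh N)\<^sup>2 * (\<Sum>m\<in>grid_indices N. \<bar>v (grid_point N m) + s * w (grid_point N m)\<bar> powr p))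
      + t / 2 * (inner_N N v v + 2 * s * inner_N N v w + s\<^sup>2 * inner_N N w w)
      - (inner_N N f v + s * inner_N N f w)" for s
    using p by (simp add: energy_def norm_N_2_squared norm_N_powr frac_laplacian_affine
        inner_N_affine inner_N_affine_right)
  show ?thesis
  proof -
    have quadratic: "((\<lambda>s. k * (a + 2 * s * b + s\<^sup>2 * c)) has_real_derivative 2 * k * b) (at 0)" for k a b c :: real
      by (auto intro!: derivative_eq_intros)
    have linear: "((\<lambda>s. a + s * b) has_real_derivative b) (at 0)" for a b :: real
      by (auto intro!: derivative_eq_intros)
    have "((\<lambda>s. energy N \<alpha> p t f (\<lambda>x. v x + s * w x)) has_real_derivative
        2 * (1 / 2) * inner_N N (?D v) (?D w) + inner_N N (\<lambda>x. power_map p (v x)) w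
        + 2 * (t / 2) * inner_N N v w - inner_N N f w) (at 0)"
      unfolding eq by (intro DERIV_diff DERIV_add quadratic potential linear)
    then show ?thesis by (simp add: energy_gradient_def)
  qed
qed

lemma dir_differentiable_energy: "p \<ge> 2 \<Longrightarrow> dir_differentiable N (energy N \<alpha> p t f)"
  unfolding dir_differentiable_def field_differentiable_def
  using energy_has_derivative by blast

lemma dir_deriv_energy: "p \<ge> 2 \<Longrightarrow> dir_deriv (energy N \<alpha> p t f) v w = energy_gradient N \<alpha> p t f v w"
  unfolding dir_deriv_def by (rule DERIV_imp_deriv) (rule energy_has_derivative)

lemma energy_gradient_diff:
  fixes v w :: "real \<times> real \<Rightarrow> real"
  defines "u \<equiv> \<lambda>x. v x - w x"
  assumes p: "p \<ge> 2"
  shows "dir_deriv (energy N \<alpha> p t f) v u - dir_deriv (energy N \<alpha> p t f) w u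
    = inner_N N (frac_laplacian N (\<alpha> / 2) u) (frac_laplacian N (\<alpha> / 2) u) + t * inner_N N u u
      + (mesh N)\<^sup>2 * (\<Sum>m\<in>grid_indices N.
          (power_map p (v (grid_point N m)) - power_map p (w (grid_point N m)))
          * (v (grid_point N m) - w (grid_point N m)))"
proof -
  have diff: "inner_N N a c - inner_N N b c = inner_N N (\<lambda>x. a x - b x) c" for a b c
    by (simp add: inner_N_def left_diff_distrib right_diff_distrib sum_subtractf)
  let ?D = "frac_laplacian N (\<alpha> / 2)"
  have "energy_gradient N \<alpha> p t f v u - energy_gradient N \<alpha> p t f w u
      = (inner_N N (?D v) (?D u) - inner_N N (?D w) (?D u))
        + (inner_N N (\<lambda>x. power_map p (v x)) u - inner_N N (\<lambda>x. power_map p (w x)) u)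
        + t * (inner_N N v u - inner_N N w u)"
    by (simp add: energy_gradient_def algebra_simps)
  also have "\<dots> = inner_N N (?D u) (?D u)
        + inner_N N (\<lambda>x. power_map p (v x) - power_map p (w x)) u + t * inner_N N u u"
    unfolding diff by (simp add: u_def frac_laplacian_diff)
  finally show ?thesis
    using p by (simp add: dir_deriv_energy) (simp add: inner_N_def u_def)
qed

section \<open>Strong convexity and local Lipschitz smoothness\<close>

lemma strongly_convex_energy:
  assumes p: "p \<ge> 2" and t: "t > 0" and \<nu>: "\<nu> > 0"
  shows "strongly_convex N \<alpha> \<nu> (energy N \<alpha> p t f) (min 1 (t / \<nu>))"
  unfolding strongly_convex_def
proof (intro conjI ballI dir_differentiable_energy p)
  fix v w :: "real \<times> real \<Rightarrow> real"
  let ?u = "\<lambda>x. v x - w x"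
  let ?D = "inner_N N (frac_laplacian N (\<alpha> / 2) ?u) (frac_laplacian N (\<alpha> / 2) ?u)"
  let ?\<mu> = "min 1 (t / \<nu>)"
  have "?\<mu> * \<nu> \<le> t / \<nu> * \<nu>"
    using \<nu> by (intro mult_right_mono) auto
  then have "?\<mu> * \<nu> * inner_N N ?u ?u \<le> t * inner_N N ?u ?u"
    using \<nu> by (intro mult_right_mono inner_N_self_nonneg) auto
  moreover have "?\<mu> * ?D \<le> 1 * ?D"
    by (intro mult_right_mono inner_N_self_nonneg) auto
  ultimately have "?\<mu> * (norm_L N \<alpha> \<nu> ?u)\<^sup>2 \<le> ?D + t * inner_N N ?u ?u"
    unfolding norm_L_squared[OF \<nu>] by (simp only: distrib_left mult.assoc)
  also have "\<dots> \<le> ?D + t * inner_N N ?u ?u + (mesh N)\<^sup>2 * (\<Sum>m\<in>grid_indices N.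
          (power_map p (v (grid_point N m)) - power_map p (w (grid_point N m)))
          * (v (grid_point N m) - w (grid_point N m)))"
    using power_map_monotone(1)[OF p] by (simp add: sum_nonneg)
  finally show "?\<mu> * (norm_L N \<alpha> \<nu> ?u)\<^sup>2
      \<le> dir_deriv (energy N \<alpha> p t f) v ?u - dir_deriv (energy N \<alpha> p t f) w ?u"
    unfolding energy_gradient_diff[OF p] .
qed

text \<open>Lipschitz smoothness on \<open>B\<close> follows once the weighted square sum that dominates the
  difference of the nonlinear terms is controlled by the \<open>\<L>\<^sub>N\<close>-norm; \<open>\<kappa>\<close> is the only part
  of the constant that depends on \<open>B\<close>.\<close>
lemma lipschitz_smooth_energy:
  assumes p: "p \<ge> 2" and t: "t > 0" and \<nu>: "\<nu> > 0"
    and bound: "\<And>v w. v \<in> B \<Longrightarrow> w \<in> B \<Longrightarrow>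
      (mesh N)\<^sup>2 * (\<Sum>m\<in>grid_indices N.
        max \<bar>v (grid_point N m)\<bar> \<bar>w (grid_point N m)\<bar> powr (p - 2) * (v (grid_point N m) - w (grid_point N m))\<^sup>2)
      \<le> \<kappa> * (norm_L N \<alpha> \<nu> (\<lambda>x. v x - w x))\<^sup>2"
  shows "lipschitz_smooth_on N \<alpha> \<nu> B (energy N \<alpha> p t f) (1 + t / \<nu> + (p - 1) * \<kappa>)"
  unfolding lipschitz_smooth_on_def
proof (intro conjI ballI dir_differentiable_energy p)
  fix v w assume vw: "v \<in> B" "w \<in> B"
  let ?u = "\<lambda>x. v x - w x"
  let ?D = "inner_N N (frac_laplacian N (\<alpha> / 2) ?u) (frac_laplacian N (\<alpha> / 2) ?u)"
  let ?n = "(norm_L N \<alpha> \<nu> ?u)\<^sup>2"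
  have "t / \<nu> * (\<nu> * inner_N N ?u ?u) \<le> t / \<nu> * ?n"
    using t \<nu> by (intro mult_left_mono inner_N_le_norm_L) auto
  then have 1: "t * inner_N N ?u ?u \<le> t / \<nu> * ?n"
    using \<nu> by simp
  have 2: "?D \<le> ?n"
    using \<nu> by (simp add: norm_L_squared inner_N_self_nonneg)
  have "(mesh N)\<^sup>2 * (\<Sum>m\<in>grid_indices N.
          (power_map p (v (grid_point N m)) - power_map p (w (grid_point N m)))
          * (v (grid_point N m) - w (grid_point N m)))
      \<le> (mesh N)\<^sup>2 * (\<Sum>m\<in>grid_indices N. (p - 1) *
        (max \<bar>v (grid_point N m)\<bar> \<bar>w (grid_point N m)\<bar> powr (p - 2) * (v (grid_point N m) - w (grid_point N m))\<^sup>2))"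
    by (intro mult_left_mono sum_mono power_map_monotone(2)[OF p]) simp
  also have "\<dots> = (p - 1) * ((mesh N)\<^sup>2 * (\<Sum>m\<in>grid_indices N.
        max \<bar>v (grid_point N m)\<bar> \<bar>w (grid_point N m)\<bar> powr (p - 2) * (v (grid_point N m) - w (grid_point N m))\<^sup>2))"
    by (simp add: mult.left_commute flip: sum_distrib_left)
  also have "\<dots> \<le> (p - 1) * (\<kappa> * ?n)"
    using p by (intro mult_left_mono bound vw) auto
  finally show "dir_deriv (energy N \<alpha> p t f) v ?u - dir_deriv (energy N \<alpha> p t f) w ?u
      \<le> (1 + t / \<nu> + (p - 1) * \<kappa>) * ?n"
    using 1 2 unfolding energy_gradient_diff[OF p] by (simp only: distrib_right mult.assoc mult_1)
qed

text \<open>On a fixed grid the \<open>\<L>\<^sub>N\<close>-norm bounds the point values, so no Sobolev inequality is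
  needed; the resulting constant deteriorates as the mesh size tends to \<open>0\<close>.\<close>
lemma locally_lipschitz_smooth_energy:
  assumes N: "N > 0" and p: "p \<ge> 2" and t: "t > 0" and \<nu>: "\<nu> > 0"
  shows "locally_lipschitz_smooth N \<alpha> \<nu> (energy N \<alpha> p t f)"
  unfolding locally_lipschitz_smooth_def
proof (intro allI impI)
  fix B
  assume "B \<subseteq> grid_space N \<and> grid_bounded N \<alpha> \<nu> B \<and> grid_convex B"
  then obtain R where R: "\<And>v. v \<in> B \<Longrightarrow> norm_L N \<alpha> \<nu> v \<le> R"
    by (auto simp: grid_bounded_def)
  have h: "mesh N > 0" using N by (simp add: mesh_def)
  define \<rho> where "\<rho> = sqrt (R\<^sup>2 / (\<nu> * (mesh N)\<^sup>2))"
  have pointwise: "\<bar>v (grid_point N m)\<bar> \<le> \<rho>" if v: "v \<in> B" and m: "m \<in> grid_indices N" for v m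
  proof -
    have "(v (grid_point N m))\<^sup>2 \<le> (\<Sum>m\<in>grid_indices N. (v (grid_point N m))\<^sup>2)"
      using m by (intro member_le_sum[of m _ "\<lambda>m. (v (grid_point N m))\<^sup>2"]) auto
    then have "\<nu> * ((mesh N)\<^sup>2 * (v (grid_point N m))\<^sup>2) \<le> \<nu> * inner_N N v v"
      unfolding inner_N_def power2_eq_square[symmetric, of "v _"] using \<nu> by (intro mult_left_mono) auto
    also have "\<dots> \<le> (norm_L N \<alpha> \<nu> v)\<^sup>2" by (rule inner_N_le_norm_L[OF \<nu>])
    also have "\<dots> \<le> R\<^sup>2" by (intro power_mono R v norm_L_nonneg \<nu>)
    finally have "(v (grid_point N m))\<^sup>2 \<le> R\<^sup>2 / (\<nu> * (mesh N)\<^sup>2)"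
      using \<nu> h by (simp add: pos_le_divide_eq mult_ac)
    then show ?thesis unfolding \<rho>_def by (intro real_le_rsqrt) simp
  qed
  have "lipschitz_smooth_on N \<alpha> \<nu> B (energy N \<alpha> p t f) (1 + t / \<nu> + (p - 1) * (\<rho> powr (p - 2) / \<nu>))"
  proof (rule lipschitz_smooth_energy[OF p t \<nu>])
    fix v w assume vw: "v \<in> B" "w \<in> B"
    let ?u = "\<lambda>x. v x - w x"
    have "(mesh N)\<^sup>2 * (\<Sum>m\<in>grid_indices N.
        max \<bar>v (grid_point N m)\<bar> \<bar>w (grid_point N m)\<bar> powr (p - 2) * (v (grid_point N m) - w (grid_point N m))\<^sup>2)
      \<le> (mesh N)\<^sup>2 * (\<Sum>m\<in>grid_indices N. \<rho> powr (p - 2) * (v (grid_point N m) - w (grid_point N m))\<^sup>2)"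
      using p pointwise vw by (intro mult_left_mono sum_mono mult_right_mono powr_mono2) auto
    also have "\<dots> = \<rho> powr (p - 2) / \<nu> * (\<nu> * inner_N N ?u ?u)"
      using \<nu> by (simp add: inner_N_def mult.left_commute power2_eq_square flip: sum_distrib_left)
    also have "\<dots> \<le> \<rho> powr (p - 2) / \<nu> * (norm_L N \<alpha> \<nu> ?u)\<^sup>2"
      using \<nu> by (intro mult_left_mono inner_N_le_norm_L) auto
    finally show "(mesh N)\<^sup>2 * (\<Sum>m\<in>grid_indices N.
        max \<bar>v (grid_point N m)\<bar> \<bar>w (grid_point N m)\<bar> powr (p - 2) * (v (grid_point N m) - w (grid_point N m))\<^sup>2)
      \<le> \<rho> powr (p - 2) / \<nu> * (norm_L N \<alpha> \<nu> ?u)\<^sup>2" .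
  qed
  moreover have "1 + t / \<nu> + (p - 1) * (\<rho> powr (p - 2) / \<nu>) > 0"
    using p t \<nu> by (intro add_pos_nonneg) auto
  ultimately show "\<exists>L>0. lipschitz_smooth_on N \<alpha> \<nu> B (energy N \<alpha> p t f) L"
    by blast
qed

section \<open>Uniform Lipschitz smoothness on sublevel sets\<close>

text \<open>Coercivity: the quadratic term with factor \<open>t / 2\<close> absorbs the linear term.\<close>
lemma powr_sum_le_of_energy_le:
  assumes p: "p \<ge> 2" and t: "t > 0" and M: "energy N \<alpha> p t f v \<le> M" and F: "norm_N N 2 f \<le> F"
  shows "(mesh N)\<^sup>2 * (\<Sum>m\<in>grid_indices N. \<bar>v (grid_point N m)\<bar> powr p) \<le> p * (M + F\<^sup>2 / (2 * t))"
proof -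
  let ?S = "(mesh N)\<^sup>2 * (\<Sum>m\<in>grid_indices N. \<bar>v (grid_point N m)\<bar> powr p)"
  have "0 \<le> inner_N N (\<lambda>x. f x + (- t) * v x) (\<lambda>x. f x + (- t) * v x)"
    by (rule inner_N_self_nonneg)
  also have "\<dots> = inner_N N f f - 2 * t * inner_N N f v + t\<^sup>2 * inner_N N v v"
    by (simp only: inner_N_affine) simp
  finally have "inner_N N f v \<le> inner_N N f f / (2 * t) + t / 2 * inner_N N v v"
    using t by (simp add: field_simps power2_eq_square)
  moreover have "inner_N N f f \<le> F\<^sup>2"
    using power_mono[OF F, of 2] by (simp add: norm_N_2_squared[symmetric] norm_N_def)
  then have "inner_N N f f / (2 * t) \<le> F\<^sup>2 / (2 * t)"
    using t by (intro divide_right_mono) auto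
  moreover have "energy N \<alpha> p t f v = 1 / 2 * inner_N N (frac_laplacian N (\<alpha> / 2) v) (frac_laplacian N (\<alpha> / 2) v)
      + 1 / p * ?S + t / 2 * inner_N N v v - inner_N N f v"
    using p by (simp add: energy_def norm_N_2_squared norm_N_powr)
  moreover have "inner_N N (frac_laplacian N (\<alpha> / 2) v) (frac_laplacian N (\<alpha> / 2) v) \<ge> 0"
    by (rule inner_N_self_nonneg)
  ultimately have "1 / p * ?S \<le> M + F\<^sup>2 / (2 * t)"
    using M by linarith
  then show ?thesis using p by (simp add: field_simps)
qed

text \<open>The quotient of \<open>u\<close> by its \<open>\<L>\<^sub>N\<close>-norm has bounded \<open>L\<^sup>p\<close> norm by the assumed
  Sobolev inequality, so the Young inequality applies to it pointwise.\<close>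
lemma weighted_square_sum_le:
  assumes p: "p \<ge> 2" and \<nu>: "\<nu> > 0"
    and sobolev: "\<And>w. norm_L N \<alpha> \<nu> w \<le> 1 \<Longrightarrow>
      (mesh N)\<^sup>2 * (\<Sum>m\<in>grid_indices N. \<bar>w (grid_point N m)\<bar> powr p) \<le> C"
    and v: "(mesh N)\<^sup>2 * (\<Sum>m\<in>grid_indices N. \<bar>v (grid_point N m)\<bar> powr p) \<le> A"
    and w: "(mesh N)\<^sup>2 * (\<Sum>m\<in>grid_indices N. \<bar>w (grid_point N m)\<bar> powr p) \<le> A"
  shows "(mesh N)\<^sup>2 * (\<Sum>m\<in>grid_indices N.
        max \<bar>v (grid_point N m)\<bar> \<bar>w (grid_point N m)\<bar> powr (p - 2) * (u (grid_point N m))\<^sup>2)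
      \<le> (2 * A + C) * (norm_L N \<alpha> \<nu> u)\<^sup>2"
proof (cases "norm_L N \<alpha> \<nu> u = 0")
  case True
  have "\<nu> * inner_N N u u \<le> 0"
    using inner_N_le_norm_L[OF \<nu>, of N u \<alpha>] True by simp
  then have "inner_N N u u = 0"
    using \<nu> inner_N_self_nonneg[of N u] by (simp add: mult_le_0_iff)
  then have "mesh N = 0 \<or> (\<forall>m\<in>grid_indices N. u (grid_point N m) = 0)"
    by (auto simp: inner_N_def sum_nonneg_eq_0_iff)
  then show ?thesis using True by auto
next
  case False
  define n where "n = norm_L N \<alpha> \<nu> u"
  have n: "n > 0" using False norm_L_nonneg[OF \<nu>, of N \<alpha> u] by (simp add: n_def)
  define y where "y x = 1 / n * u x" for x
  have "norm_L N \<alpha> \<nu> y = 1"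
    unfolding y_def norm_L_scale using n by (simp add: n_def)
  then have y: "(mesh N)\<^sup>2 * (\<Sum>m\<in>grid_indices N. \<bar>y (grid_point N m)\<bar> powr p) \<le> C"
    by (intro sobolev) simp
  have young: "max \<bar>a\<bar> \<bar>b\<bar> powr (p - 2) * c\<^sup>2 \<le> \<bar>a\<bar> powr p + \<bar>b\<bar> powr p + \<bar>c\<bar> powr p" for a b c :: real
  proof -
    have "max \<bar>a\<bar> \<bar>b\<bar> powr (p - 2) * \<bar>c\<bar>\<^sup>2 \<le> max \<bar>a\<bar> \<bar>b\<bar> powr p + \<bar>c\<bar> powr p"
      by (rule powr_mult_square_le[OF p]) auto
    moreover have "max \<bar>a\<bar> \<bar>b\<bar> powr p \<le> \<bar>a\<bar> powr p + \<bar>b\<bar> powr p"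
      by (auto simp: max_def)
    ultimately show ?thesis by simp
  qed
  have "(mesh N)\<^sup>2 * (\<Sum>m\<in>grid_indices N.
        max \<bar>v (grid_point N m)\<bar> \<bar>w (grid_point N m)\<bar> powr (p - 2) * (u (grid_point N m))\<^sup>2)
     = n\<^sup>2 * ((mesh N)\<^sup>2 * (\<Sum>m\<in>grid_indices N.
        max \<bar>v (grid_point N m)\<bar> \<bar>w (grid_point N m)\<bar> powr (p - 2) * (y (grid_point N m))\<^sup>2))"
    using n by (simp add: y_def power_divide sum_divide_distrib[symmetric])
  also have "\<dots> \<le> n\<^sup>2 * ((mesh N)\<^sup>2 * (\<Sum>m\<in>grid_indices N.
        \<bar>v (grid_point N m)\<bar> powr p + \<bar>w (grid_point N m)\<bar> powr p + \<bar>y (grid_point N m)\<bar> powr p))"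
    by (intro mult_left_mono sum_mono young) auto
  also have "\<dots> \<le> n\<^sup>2 * (2 * A + C)"
    using v w y by (intro mult_left_mono) (auto simp: sum.distrib distrib_left)
  finally show ?thesis by (simp add: n_def mult.commute)
qed

section \<open>Strong convexity and uniform smoothness of the energies\<close>

theorem theorem6p6:
  fixes \<alpha> p t \<nu> :: real and f :: "nat \<Rightarrow> real \<times> real \<Rightarrow> real"
  assumes "\<alpha> > 0" "p \<ge> 2" "t > 0" "\<nu> > 0"
    and "\<forall>N\<in>grid_sizes. f N \<in> grid_space N"
  shows "\<exists>\<mu>>0.
    (\<forall>N\<in>grid_sizes.
       strongly_convex N \<alpha> \<nu> (energy N \<alpha> p t (f N)) \<mu> \<and>
       locally_lipschitz_smooth N \<alpha> \<nu> (energy N \<alpha> p t (f N))) \<and>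
    (\<alpha> \<le> 1 \<and> (\<alpha> < 1 \<longrightarrow> p \<le> 2 / (1 - \<alpha>)) \<and>
     (\<exists>F C. square_integrable F \<and> C > 0 \<and>
        (\<forall>N\<in>grid_sizes. norm_N N 2 (f N) \<le> C * L2_norm F)) \<longrightarrow>
     (\<forall>M. \<exists>L>0.
        (\<forall>N\<in>grid_sizes.
           lipschitz_smooth_on N \<alpha> \<nu> (sublevel N (energy N \<alpha> p t (f N)) M)
             (energy N \<alpha> p t (f N)) L) \<and>
        (\<exists>c>0. \<forall>N\<in>grid_sizes. c \<le> \<mu> / L)))"
proof -
  define \<mu> where "\<mu> = min 1 (t / \<nu>)"
  have \<mu>0: "\<mu> > 0" using assms(3,4) by (simp add: \<mu>_def)
  have convex: "strongly_convex N \<alpha> \<nu> (energy N \<alpha> p t (f N)) \<mu>" for N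
    unfolding \<mu>_def using assms(2-4) by (rule strongly_convex_energy)
  have locally_smooth: "locally_lipschitz_smooth N \<alpha> \<nu> (energy N \<alpha> p t (f N))" if "N \<in> grid_sizes" for N
    using that assms(2-4) by (intro locally_lipschitz_smooth_energy) (auto simp: grid_sizes_def)
  have uniform: "\<exists>L>0. (\<forall>N\<in>grid_sizes.
           lipschitz_smooth_on N \<alpha> \<nu> (sublevel N (energy N \<alpha> p t (f N)) M)
             (energy N \<alpha> p t (f N)) L) \<and> (\<exists>c>0. \<forall>N\<in>grid_sizes. c \<le> \<mu> / L)"
    if \<alpha>: "\<alpha> \<le> 1" "\<alpha> < 1 \<longrightarrow> p \<le> 2 / (1 - \<alpha>)"
      and F: "\<forall>N\<in>grid_sizes. norm_N N 2 (f N) \<le> F" for M F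
  proof -
    have "1 - 2 / p \<le> \<alpha>"
    proof (cases "\<alpha> < 1")
      case True
      then show ?thesis using \<alpha>(2) assms(2) by (simp add: field_simps)
    next
      case False
      have "1 - 2 / p \<le> 1" using assms(2) by simp
      then show ?thesis using False by linarith
    qed
    then obtain C where C: "C \<ge> 0" "\<And>N w. N \<in> grid_sizes \<Longrightarrow> norm_L N \<alpha> \<nu> w \<le> 1 \<Longrightarrow>
        (mesh N)\<^sup>2 * (\<Sum>m\<in>grid_indices N. \<bar>w (grid_point N m)\<bar> powr p) \<le> C"
      using discrete_sobolev[OF assms(2) _ assms(4)] by blast
    \<comment> \<open>The absolute value keeps the constants nonnegative when the sublevel set is empty.\<close>
    define A where "A = p * (\<bar>M\<bar> + F\<^sup>2 / (2 * t))"
    define L where "L = 1 + t / \<nu> + (p - 1) * (2 * A + C)"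
    have "A \<ge> 0" using assms(2,3) by (simp add: A_def)
    then have L0: "L > 0"
      unfolding L_def using assms(2-4) C(1) by (intro add_pos_nonneg) auto
    have "lipschitz_smooth_on N \<alpha> \<nu> (sublevel N (energy N \<alpha> p t (f N)) M) (energy N \<alpha> p t (f N)) L"
      if N: "N \<in> grid_sizes" for N
      unfolding L_def
    proof (rule lipschitz_smooth_energy[OF assms(2-4)], rule weighted_square_sum_le[OF assms(2,4) C(2)[OF N]])
      fix v w
      assume "v \<in> sublevel N (energy N \<alpha> p t (f N)) M" "w \<in> sublevel N (energy N \<alpha> p t (f N)) M"
      then have "energy N \<alpha> p t (f N) v \<le> \<bar>M\<bar>" "energy N \<alpha> p t (f N) w \<le> \<bar>M\<bar>"
        by (auto simp: sublevel_def)
      then show "(mesh N)\<^sup>2 * (\<Sum>m\<in>grid_indices N. \<bar>v (grid_point N m)\<bar> powr p) \<le> A"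
        "(mesh N)\<^sup>2 * (\<Sum>m\<in>grid_indices N. \<bar>w (grid_point N m)\<bar> powr p) \<le> A"
        unfolding A_def using F N by (auto intro!: powr_sum_le_of_energy_le[OF assms(2,3)])
    qed
    moreover have "\<exists>c>0. \<forall>N\<in>grid_sizes. c \<le> \<mu> / L"
      using \<mu>0 L0 by (intro exI[of _ "\<mu> / L"]) simp
    ultimately show ?thesis using L0 by blast
  qed
  show ?thesis
    using \<mu>0 convex locally_smooth uniform by (intro exI[of _ \<mu>]) blast
qed

end
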